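(* Suppose $\nu$ is a positive integer and $c>1$. For any $p\in[1,2]$, with $p^{-1}+p'^{-1}=1$, the supremum $$K_{11}(p,\nu,c):=\sup_{\gamma\in\mathfrak{R}(\nu,c)}\|\mathcal{L}_\gamma\|_{L^p(\mathbb{R}_+)\to L^{p'}(\gamma)}$$ taken over all simple discontinuous radial curves $\gamma$ of the class $\mathfrak{R}(\nu,c)$ is finite and $$K_{11}(p,\nu,c)\le\left(18\cdot8\cdot24\left(\frac{\log2}{\log c}+\nu+2\right)\right)^{1/p'}.$$
   Context: $\mathbb{R}_+=(0,\infty)$, $\mathbb{C}_+=\{z:\mathrm{Re}\,z>0\}$. A simple discontinuous radial curve in $\mathbb{C}_+$ is given by numbers $0\le r_0<r_1<\dots<r_{N-1}<r_N\le\infty$ and angles $\alpha_1,\dots,\alpha_N\in(-\pi/2,\pi/2)$: it is the finite family $\gamma=\{\gamma_n\}_{n=1}^N$, where $\gamma_n$ is the radial segment (a ray if $n=N$ and $r_N=\infty$) connecting $r_{n-1}e^{i\alpha_n}$ and $r_ne^{i\alpha_n}$. (Equivalently, it has the polar equation $\theta=\alpha(r)$ with $\alpha(r)=\alpha_n$ for $r_{n-1}\le r<r_n$.) Its measure is the total arclength (i.e. the measure $dr$), and $L^{p'}(\gamma)$ is taken with respect to it. $\mathfrak{R}(\nu,c)$ is the class of simple discontinuous radial curves in $\mathbb{C}_+$ (with any $N$) such that $r_{n+\nu}\ge c^\nu r_n$ whenever $n+\nu\le N$. $\mathcal{L}_\gamma f$ is the restriction to $\gamma$ of the Laplace transform $\mathcal{L}f(z)=\int_0^\infty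 f(t)e^{-zt}\,dt$. *)

theory Defs
  imports "HOL-Probability.Essential_Supremum"
begin

text \<open>
  Extended \<open>L\<^sup>q\<close> norm for \<open>1 \<le> q \<le> \<infinity>\<close>. As for \<open>esssup\<close>, it is \<open>\<infinity>\<close> on
  non-measurable functions, so that a finite value amounts to membership in \<open>L\<^sup>q\<close>.
\<close>
definition Lp_norm :: "ennreal \<Rightarrow> 'a measure \<Rightarrow> ('a \<Rightarrow> complex) \<Rightarrow> ennreal" where
  "Lp_norm q M f =
    (if f \<notin> borel_measurable M then \<infinity>
     else if q = \<infinity> then esssup M (\<lambda>x. ennreal (cmod (f x)))
     else let I = (\<integral>\<^sup>+ x. ennreal (cmod (f x) powr enn2real q) \<partial>M)
          in if I = \<infinity> then \<infinity> else ennreal (enn2real I powr (1 / enn2real q)))"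

definition Lp_operator_norm ::
  "ennreal \<Rightarrow> 'a measure \<Rightarrow> ennreal \<Rightarrow> 'b measure \<Rightarrow> (('a \<Rightarrow> complex) \<Rightarrow> 'b \<Rightarrow> complex) \<Rightarrow> ennreal" where
  "Lp_operator_norm p M q M' T = (SUP f \<in> {f. Lp_norm p M f \<le> 1}. Lp_norm q M' (T f))"

definition half_line :: "real measure" where
  "half_line = restrict_space lborel {0<..}"

definition laplace :: "(real \<Rightarrow> complex) \<Rightarrow> complex \<Rightarrow> complex" where
  "laplace f z = (\<integral>t. f t * exp (- (z * complex_of_real t)) \<partial>half_line)"

text \<open>
  The \<open>n\<close>-th piece, \<open>1 \<le> n \<le> pieces \<gamma>\<close>, joins \<open>radius \<gamma> (n - 1) * cis (angle \<gamma> n)\<close> to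
  \<open>radius \<gamma> n * cis (angle \<gamma> n)\<close>. Values of \<open>radius\<close> and \<open>angle\<close> at other indices are
  never used.
\<close>
record radial_curve =
  pieces :: nat
  radius :: "nat \<Rightarrow> ereal"
  angle :: "nat \<Rightarrow> real"

definition simple_radial_curve :: "radial_curve \<Rightarrow> bool" where
  "simple_radial_curve \<gamma> \<longleftrightarrow>
    1 \<le> pieces \<gamma> \<and>
    0 \<le> radius \<gamma> 0 \<and>
    (\<forall>n\<in>{1..pieces \<gamma>}. radius \<gamma> (n - 1) < radius \<gamma> n) \<and>
    (\<forall>n\<in>{1..pieces \<gamma>}. angle \<gamma> n \<in> {- pi / 2 <..< pi / 2})"

definition polar_angle :: "radial_curve \<Rightarrow> real \<Rightarrow> real" where
  "polar_angle \<gamma> s =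
    angle \<gamma> (THE n. n \<in> {1..pieces \<gamma>} \<and> radius \<gamma> (n - 1) \<le> ereal s \<and> ereal s < radius \<gamma> n)"

text \<open>
  Arclength on the curve, as a measure on the complex plane: every piece is radial, so it is
  the image of Lebesgue measure in the distance \<open>s\<close> to the origin. The pieces
  have pairwise disjoint ranges of \<open>s\<close> up to end points, which are null, so nothing is
  counted twice.
\<close>
definition curve_measure :: "radial_curve \<Rightarrow> complex measure" where
  "curve_measure \<gamma> =
    distr (restrict_space lborel {s. radius \<gamma> 0 \<le> ereal s \<and> ereal s < radius \<gamma> (pieces \<gamma>)})
      borel (\<lambda>s. complex_of_real s * cis (polar_angle \<gamma> s))"

definition radial_class :: "nat \<Rightarrow> real \<Rightarrow> radial_curve set" where
  "radial_class \<nu> c =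
    {\<gamma>. simple_radial_curve \<gamma> \<and>
        (\<forall>n. n + \<nu> \<le> pieces \<gamma> \<longrightarrow> ereal (c ^ \<nu>) * radius \<gamma> n \<le> radius \<gamma> (n + \<nu>))}"

definition K11 :: "ennreal \<Rightarrow> ennreal \<Rightarrow> nat \<Rightarrow> real \<Rightarrow> ennreal" where
  "K11 p p' \<nu> c =
    (SUP \<gamma> \<in> radial_class \<nu> c. Lp_operator_norm p half_line p' (curve_measure \<gamma>) laplace)"

end

theory Submission
  imports Defs "HOL-Complex_Analysis.Conformal_Mappings"
begin

text \<open>
  For \<open>p = 1\<close> the bound is \<open>\<bar>exp (- z t)\<bar> \<le> 1\<close>, and the intermediate cases follow by Riesz--Thorin
  interpolation from \<open>p = 2\<close>. There every measurable polar curve \<open>z(r) = x(r) + i y(r)\<close> with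
  \<open>\<bar>z(r)\<bar> = r\<close> works, uniformly, whence neither \<open>\<nu>\<close> nor \<open>c\<close> enters the constant \<open>384 \<pi>\<close> obtained here.
  By duality one bounds \<open>\<integral>\<^sub>0\<^sup>\<infinity> \<bar>\<integral> g(r) exp (- cnj z(r) t) dr\<bar>\<^sup>2 dt\<close>. Integrating over all
  \<open>t \<in> \<real>\<close> with \<open>exp (- x(r) \<bar>t\<bar>)\<close> in place of \<open>exp (- x(r) t)\<close>, this is at most a quadratic form
  in \<open>\<bar>g\<bar>\<close> with the Poisson kernel of height \<open>x(r) + x(s)\<close> at \<open>y(r) - y(s)\<close>, hence, on the part of the
  curve in a quadrant, at most a multiple of the form with the kernel of height \<open>x(r)\<close> at \<open>r - s\<close>.
  The latter is the linearized maximal operator paired with \<open>\<bar>g\<bar>\<close>, and it bounds its own square.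
\<close>

text \<open>The difficulty at p = 2 is uniformity near the imaginary axis: the heights x(r) may be
  arbitrarily small there, and they vary with r without any regularity. Absolute values taken inside
  the integral over t would leave 2 / (x(r) + x(s)), which is out of control; the oscillation must
  be integrated as well, so that the kernel decays in y(r) - y(s). Now |z(r)| = r gives 0 \<le> r -
  y(r) \<le> x(r) in the upper quadrant, so r - s and y(r) - y(s) differ by at most the larger
  height, and passing from one to the other costs a constant. The self-bounding estimate takes the
  place of a covering argument: it uses only the mass of the kernel and its stability when the
  argument is halved. The constant collects 4 pi from the product of two kernels, 2 from its two
  symmetric terms, 2 from the two half-lines of t, 6 from the change to r - s, 2 from symmetry again
  and 2 from the two quadrants. A quantity can be cancelled from its own bound only if it is finite.
  Hence the compact supports, the upper bounds and the heights at least \<delta>; no estimate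
  depends on them, and Fatou's lemma removes them in the end.\<close>

section \<open>The linearized Poisson maximal operator\<close>

text \<open>This is \<open>\<pi>\<close> times the Poisson kernel of the right half-plane.\<close>
definition poisson :: "real \<Rightarrow> real \<Rightarrow> real" where
  "poisson a d = a / (a\<^sup>2 + d\<^sup>2)"

lemma poisson_nonneg [simp]: "0 < a \<Longrightarrow> 0 \<le> poisson a d"
  by (simp add: poisson_def)

lemma poisson_minus [simp]: "poisson a (- d) = poisson a d"
  by (simp add: poisson_def)

lemma measurable_poisson [measurable (raw)]:
  assumes "f \<in> borel_measurable M" "g \<in> borel_measurable M"
  shows "(\<lambda>x. poisson (f x) (g x)) \<in> borel_measurable M"
  using assms unfolding poisson_def by measurable

lemma poisson_le_inverse:
  assumes "0 < \<delta>" "\<delta> \<le> a"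
  shows "poisson a d \<le> 1 / \<delta>"
proof -
  have "\<delta> * a \<le> a * a" using assms by (intro mult_right_mono) auto
  also have "\<dots> \<le> a\<^sup>2 + d\<^sup>2" by (simp add: power2_eq_square)
  finally show ?thesis
    using assms by (simp add: poisson_def field_simps sum_power2_gt_zero_iff)
qed

text \<open>The denominators satisfy a^2 + D^2 \<le> 4 (a^2 + u^2). In the application
  \<open>D\<close> is the distance between two centres and \<open>u\<close> the distance of a third
  point from the farther one, which is at least half of \<open>D\<close>.\<close>

lemma poisson_half:
  assumes "0 < a" "\<bar>D\<bar> \<le> 2 * \<bar>u\<bar>"
  shows "poisson a u \<le> 4 * poisson a D"
proof -
  have "D\<^sup>2 \<le> (2 * u)\<^sup>2" using assms(2) by (metis abs_le_square_iff abs_mult abs_numeral)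
  hence "a\<^sup>2 + D\<^sup>2 \<le> 4 * (a\<^sup>2 + u\<^sup>2)" by (simp add: power_mult_distrib add_increasing)
  moreover have "0 < a\<^sup>2 + D\<^sup>2" "0 < a\<^sup>2 + u\<^sup>2" using assms by (simp_all add: add_pos_nonneg)
  ultimately have "1 / (a\<^sup>2 + u\<^sup>2) \<le> 4 / (a\<^sup>2 + D\<^sup>2)" by (simp add: field_simps)
  from mult_left_mono[OF this, of a] show ?thesis using assms by (simp add: poisson_def mult.commute)
qed

lemma nn_integral_poisson_le:
  assumes "0 < a"
  shows "(\<integral>\<^sup>+ d. ennreal (poisson a d) \<partial>lborel) \<le> ennreal pi"
proof -
  let ?f = "\<lambda>d. ennreal (poisson a d) * indicator {0..} d"
  have I: "(\<integral>\<^sup>+ d. ?f d \<partial>lborel) = ennreal (pi / 2 - arctan (0 / a))"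
  proof (rule nn_integral_FTC_atLeast)
    show "((\<lambda>d. arctan (d / a)) \<longlongrightarrow> pi / 2) at_top"
      using filterlim_compose[OF tendsto_arctan_at_top
          filterlim_tendsto_pos_mult_at_top[OF tendsto_const[of "1 / a"] _ filterlim_ident]] assms
      by (simp add: mult.commute)
    show "((\<lambda>d. arctan (d / a)) has_real_derivative poisson a x) (at x)" for x
      using assms by (auto intro!: derivative_eq_intros simp: poisson_def field_simps power2_eq_square)
  qed (use assms in auto)
  have "(\<integral>\<^sup>+ d. ennreal (poisson a d) \<partial>lborel) \<le> (\<integral>\<^sup>+ d. ?f d + ?f (- d) \<partial>lborel)"
    by (intro nn_integral_mono) (auto simp: indicator_def)
  also have "\<dots> = (\<integral>\<^sup>+ d. ?f d \<partial>lborel) + (\<integral>\<^sup>+ d. ?f (- d) \<partial>lborel)"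
    by (rule nn_integral_add) auto
  also have "(\<integral>\<^sup>+ d. ?f (- d) \<partial>lborel) = (\<integral>\<^sup>+ d. ?f d \<partial>lborel)"
    using nn_integral_real_affine[of ?f "-1" 0] by simp
  finally show ?thesis using assms by (simp add: I flip: ennreal_plus)
qed

lemma nn_integral_poisson_shift_le:
  assumes "0 < a"
  shows "(\<integral>\<^sup>+ s. ennreal (poisson a (r - s)) \<partial>lborel) \<le> ennreal pi"
proof -
  have "(\<integral>\<^sup>+ s. ennreal (poisson a (r - s)) \<partial>lborel) = (\<integral>\<^sup>+ d. ennreal (poisson a d) \<partial>lborel)"
    using nn_integral_real_affine[of "\<lambda>d. ennreal (poisson a d)" "-1" r] by simp
  with nn_integral_poisson_le[OF assms] show ?thesis by simp
qed

text \<open>Every \<open>s\<close> is at distance at least |r - q| / 2 from \<open>r\<close> or from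
  \<open>q\<close>. The kernel centred at that point is at most 4 times its value at
  \<open>r - q\<close>, and the remaining one has mass at most pi. The exact convolution would be pi
  times the kernel of height a + b; the bound by two terms with one height each is what reproduces
  the original quadratic form.\<close>

lemma nn_integral_poisson_mult_poisson_le:
  assumes "0 < a" "0 < b"
  shows "(\<integral>\<^sup>+ s. ennreal (poisson a (r - s)) * ennreal (poisson b (q - s)) \<partial>lborel)
    \<le> ennreal (4 * pi) * (ennreal (poisson a (r - q)) + ennreal (poisson b (r - q)))"
proof -
  have "ennreal (poisson a (r - s)) * ennreal (poisson b (q - s)) \<le>
    ennreal (4 * poisson a (r - q)) * ennreal (poisson b (q - s)) + ennreal (4 * poisson b (r - q)) * ennreal (poisson a (r - s))"
    for s
  proof (cases "\<bar>r - q\<bar> \<le> 2 * \<bar>r - s\<bar>")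
    case True
    from poisson_half[OF assms(1) this] show ?thesis
      by (intro add_increasing2 mult_right_mono ennreal_leI) auto
  next
    case False
    hence "\<bar>r - q\<bar> \<le> 2 * \<bar>q - s\<bar>"
      by (smt (verit, ccfv_threshold))
    from poisson_half[OF assms(2) this] show ?thesis
      by (subst mult.commute) (intro add_increasing mult_right_mono ennreal_leI, auto)
  qed
  hence "(\<integral>\<^sup>+ s. ennreal (poisson a (r - s)) * ennreal (poisson b (q - s)) \<partial>lborel) \<le>
    (\<integral>\<^sup>+ s. ennreal (4 * poisson a (r - q)) * ennreal (poisson b (q - s)) +
       ennreal (4 * poisson b (r - q)) * ennreal (poisson a (r - s)) \<partial>lborel)"
    by (rule nn_integral_mono)
  also have "\<dots> = ennreal (4 * poisson a (r - q)) * (\<integral>\<^sup>+ s. ennreal (poisson b (q - s)) \<partial>lborel) +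
    ennreal (4 * poisson b (r - q)) * (\<integral>\<^sup>+ s. ennreal (poisson a (r - s)) \<partial>lborel)"
    by (simp add: nn_integral_add nn_integral_cmult)
  also have "\<dots> \<le> ennreal (4 * poisson a (r - q)) * ennreal pi + ennreal (4 * poisson b (r - q)) * ennreal pi"
    using assms by (intro add_mono mult_left_mono nn_integral_poisson_shift_le) auto
  also have "\<dots> = ennreal (4 * pi) * (ennreal (poisson a (r - q)) + ennreal (poisson b (r - q)))"
    using assms by (simp add: algebra_simps flip: ennreal_mult' ennreal_plus)
  finally show ?thesis .
qed

text \<open>
  Linearized maximal operator, \<open>x\<close> being an arbitrary measurable function. With
  \<open>W s = \<integral> g r * poisson (x r) (r - s) dr\<close>, the bound on the product of two kernels gives
  \<open>\<parallel>W\<parallel>\<^sup>2 \<le> 8\<pi> \<langle>g, W\<rangle> \<le> 8\<pi> \<parallel>g\<parallel> \<parallel>W\<parallel>\<close>; the bounds on \<open>g\<close> and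
  \<open>x\<close> only serve to make \<open>\<parallel>W\<parallel>\<close> finite, so that it can be cancelled.
\<close>
lemma poisson_form_bound:
  fixes g x :: "real \<Rightarrow> real"
  assumes [measurable]: "g \<in> borel_measurable borel" "x \<in> borel_measurable borel"
    and g: "\<And>r. 0 \<le> g r" "\<And>r. g r \<le> b" "\<And>r. r \<notin> {c..d} \<Longrightarrow> g r = 0"
    and x: "\<And>r. g r \<noteq> 0 \<Longrightarrow> \<delta> \<le> x r" and "0 < \<delta>"
  shows "(\<integral>\<^sup>+ r. \<integral>\<^sup>+ s. ennreal (g r) * ennreal (g s) * ennreal (poisson (x r) (r - s)) \<partial>lborel \<partial>lborel)
    \<le> ennreal (8 * pi) * (\<integral>\<^sup>+ r. ennreal ((g r)\<^sup>2) \<partial>lborel)"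
proof -
  have b: "0 \<le> b" using g(1,2) order_trans by blast
  have xp: "0 < x r" if "g r \<noteq> 0" for r using x[OF that] \<open>0 < \<delta>\<close> by simp
  define W where "W s = (\<integral>\<^sup>+ r. ennreal (g r) * ennreal (poisson (x r) (r - s)) \<partial>lborel)" for s
  have [measurable]: "W \<in> borel_measurable borel" unfolding W_def by measurable
  define J where "J = (\<integral>\<^sup>+ s. ennreal (g s) * W s \<partial>lborel)"
  define G where "G = (\<integral>\<^sup>+ r. ennreal ((g r)\<^sup>2) \<partial>lborel)"
  define X where "X = (\<integral>\<^sup>+ s. (W s)\<^sup>2 \<partial>lborel)"
  have JF: "(\<integral>\<^sup>+ r. \<integral>\<^sup>+ s. ennreal (g r) * ennreal (g s) * ennreal (poisson (x r) (r - s)) \<partial>lborel \<partial>lborel) = J"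
    unfolding J_def W_def
    by (subst lborel_pair.Fubini') (auto simp: nn_integral_cmult[symmetric] mult_ac intro!: nn_integral_cong)
  have L1: "(\<integral>\<^sup>+ r. ennreal (g r) \<partial>lborel) < \<infinity>"
  proof -
    have "(\<integral>\<^sup>+ r. ennreal (g r) \<partial>lborel) \<le> (\<integral>\<^sup>+ r. ennreal b * indicator {c..d} r \<partial>lborel)"
      using g by (intro nn_integral_mono) (auto simp: indicator_def intro!: ennreal_leI)
    also have "\<dots> < \<infinity>" using emeasure_lborel_Icc_eq[of c d] by (auto simp: nn_integral_cmult ennreal_mult_less_top)
    finally show ?thesis .
  qed
  have Gfin: "G < \<infinity>"
  proof -
    have "G \<le> (\<integral>\<^sup>+ r. ennreal (b\<^sup>2) * indicator {c..d} r \<partial>lborel)"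
      unfolding G_def using g
      by (intro nn_integral_mono) (auto simp: indicator_def intro!: ennreal_leI power_mono)
    also have "\<dots> < \<infinity>" using emeasure_lborel_Icc_eq[of c d] by (auto simp: nn_integral_cmult ennreal_mult_less_top)
    finally show ?thesis .
  qed
  have WL1: "(\<integral>\<^sup>+ s. W s \<partial>lborel) < \<infinity>"
  proof -
    have "(\<integral>\<^sup>+ s. W s \<partial>lborel) = (\<integral>\<^sup>+ r. \<integral>\<^sup>+ s. ennreal (g r) * ennreal (poisson (x r) (r - s)) \<partial>lborel \<partial>lborel)"
      unfolding W_def by (subst lborel_pair.Fubini') auto
    also have "\<dots> \<le> (\<integral>\<^sup>+ r. ennreal (g r) * ennreal pi \<partial>lborel)"
    proof (intro nn_integral_mono)
      fix r show "(\<integral>\<^sup>+ s. ennreal (g r) * ennreal (poisson (x r) (r - s)) \<partial>lborel) \<le> ennreal (g r) * ennreal pi"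
        using nn_integral_poisson_shift_le[OF xp] by (cases "g r = 0") (auto simp: nn_integral_cmult intro!: mult_left_mono)
    qed
    also have "\<dots> < \<infinity>" using L1 by (simp add: nn_integral_multc ennreal_mult_less_top)
    finally show ?thesis .
  qed
  define K where "K = ennreal (1 / \<delta>) * (\<integral>\<^sup>+ r. ennreal (g r) \<partial>lborel)"
  have K: "K < \<infinity>" using L1 by (simp add: K_def ennreal_mult_less_top)
  have WK: "W s \<le> K" for s
  proof -
    have "ennreal (g r) * ennreal (poisson (x r) (r - s)) \<le> ennreal (1 / \<delta>) * ennreal (g r)" for r
      using poisson_le_inverse[OF \<open>0 < \<delta>\<close> x, of r] by (cases "g r = 0") (auto simp: mult.commute intro!: mult_left_mono ennreal_leI)
    thus ?thesis unfolding W_def K_def by (subst nn_integral_cmult[symmetric]) (auto intro!: nn_integral_mono)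
  qed
  \<comment> \<open>The square norm is at most sup norm times L1 norm: the first is finite because
    heights are at least \<delta>, the second because each kernel has mass at most pi.\<close>
  have Xfin: "X < \<infinity>"
  proof -
    have "X \<le> (\<integral>\<^sup>+ s. K * W s \<partial>lborel)"
      unfolding X_def by (intro nn_integral_mono) (auto simp: power2_eq_square intro!: mult_right_mono WK)
    also have "\<dots> < \<infinity>" using K WL1 by (simp add: nn_integral_cmult ennreal_mult_less_top)
    finally show ?thesis .
  qed
  have XJ: "X \<le> ennreal (8 * pi) * J"
  proof -
    have "X = (\<integral>\<^sup>+ s. \<integral>\<^sup>+ r. \<integral>\<^sup>+ q. ennreal (g r) * ennreal (g q) *
        (ennreal (poisson (x r) (r - s)) * ennreal (poisson (x q) (q - s))) \<partial>lborel \<partial>lborel \<partial>lborel)"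
    proof -
      have W2: "(W s)\<^sup>2 = (\<integral>\<^sup>+ r. ennreal (g r) * ennreal (poisson (x r) (r - s)) * W s \<partial>lborel)" for s
        unfolding power2_eq_square by (subst (1) W_def, subst nn_integral_multc) auto
      have "(W s)\<^sup>2 = (\<integral>\<^sup>+ r. \<integral>\<^sup>+ q. ennreal (g r) * ennreal (g q) *
        (ennreal (poisson (x r) (r - s)) * ennreal (poisson (x q) (q - s))) \<partial>lborel \<partial>lborel)" for s
        unfolding W2 by (subst W_def, subst nn_integral_cmult[symmetric]) (auto simp: mult_ac)
      thus ?thesis unfolding X_def by simp
    qed
    also have "\<dots> = (\<integral>\<^sup>+ r. \<integral>\<^sup>+ s. \<integral>\<^sup>+ q. ennreal (g r) * ennreal (g q) *
        (ennreal (poisson (x r) (r - s)) * ennreal (poisson (x q) (q - s))) \<partial>lborel \<partial>lborel \<partial>lborel)"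
      by (rule lborel_pair.Fubini') measurable
    also have "\<dots> = (\<integral>\<^sup>+ r. \<integral>\<^sup>+ q. \<integral>\<^sup>+ s. ennreal (g r) * ennreal (g q) *
        (ennreal (poisson (x r) (r - s)) * ennreal (poisson (x q) (q - s))) \<partial>lborel \<partial>lborel \<partial>lborel)"
      by (intro nn_integral_cong lborel_pair.Fubini') measurable
    also have "\<dots> \<le> (\<integral>\<^sup>+ r. \<integral>\<^sup>+ q. ennreal (4 * pi) * (ennreal (g r) * ennreal (g q) * ennreal (poisson (x r) (r - q))
         + ennreal (g r) * ennreal (g q) * ennreal (poisson (x q) (r - q))) \<partial>lborel \<partial>lborel)"
    proof (intro nn_integral_mono)
      fix r q
      show "(\<integral>\<^sup>+ s. ennreal (g r) * ennreal (g q) *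
        (ennreal (poisson (x r) (r - s)) * ennreal (poisson (x q) (q - s))) \<partial>lborel) \<le> ennreal (4 * pi) *
          (ennreal (g r) * ennreal (g q) * ennreal (poisson (x r) (r - q)) + ennreal (g r) * ennreal (g q) * ennreal (poisson (x q) (r - q)))"
      proof (cases "g r = 0 \<or> g q = 0")
        case False
        hence "(\<integral>\<^sup>+ s. ennreal (poisson (x r) (r - s)) * ennreal (poisson (x q) (q - s)) \<partial>lborel)
          \<le> ennreal (4 * pi) * (ennreal (poisson (x r) (r - q)) + ennreal (poisson (x q) (r - q)))"
          by (intro nn_integral_poisson_mult_poisson_le xp) auto
        from mult_left_mono[OF this, of "ennreal (g r) * ennreal (g q)"] show ?thesis
          by (simp add: nn_integral_cmult distrib_left mult_ac)
      qed auto
    qed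
    also have "\<dots> = ennreal (4 * pi) * ((\<integral>\<^sup>+ r. \<integral>\<^sup>+ q. ennreal (g r) * ennreal (g q) * ennreal (poisson (x r) (r - q)) \<partial>lborel \<partial>lborel)
         + (\<integral>\<^sup>+ r. \<integral>\<^sup>+ q. ennreal (g r) * ennreal (g q) * ennreal (poisson (x q) (r - q)) \<partial>lborel \<partial>lborel))"
      by (simp add: nn_integral_cmult nn_integral_add)
    \<comment> \<open>With the height attached to the inner variable the form is \<open>J\<close> by
      definition, up to evenness of the kernel; with the height attached to the outer variable it is
      \<open>J\<close> after exchanging the integrals. This turns 4 pi into 8 pi.\<close>
    also have "(\<integral>\<^sup>+ r. \<integral>\<^sup>+ q. ennreal (g r) * ennreal (g q) * ennreal (poisson (x q) (r - q)) \<partial>lborel \<partial>lborel) = J"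
    proof -
      have "ennreal (poisson (x q) (r - q)) = ennreal (poisson (x q) (q - r))" for r q
        using poisson_minus[of "x q" "q - r"] by simp
      thus ?thesis unfolding J_def W_def
        by (auto simp: nn_integral_cmult[symmetric] mult.assoc
          intro!: nn_integral_cong arg_cong2[where f = "(*)"])
    qed
    also note JF
    also have "ennreal (4 * pi) * (J + J) = ennreal (8 * pi) * J"
      by (simp add: mult_2[symmetric] ennreal_mult' flip: mult.assoc) (simp add: ennreal_mult'[symmetric] mult_ac flip: ennreal_numeral)
    finally show ?thesis .
  qed
  have CS: "J\<^sup>2 \<le> G * X"
  proof -
    have "(\<lambda>r. ennreal (g r) ^ 2) = (\<lambda>r. ennreal ((g r)\<^sup>2))" using g(1) by (simp add: ennreal_power)
    thus ?thesis using Cauchy_Schwarz_nn_integral[of "\<lambda>r. ennreal (g r)" lborel W]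
      unfolding J_def G_def X_def by simp
  qed
  have "J \<le> ennreal (8 * pi) * G"
  proof -
    have "J\<^sup>2 < \<infinity>" using CS Gfin Xfin by (auto simp: ennreal_mult_less_top intro: le_less_trans)
    hence "J < \<infinity>" by (auto simp: power2_eq_square ennreal_mult_less_top less_top[symmetric])
    moreover have "J * J \<le> ennreal (8 * pi) * G * J"
      using order_trans[OF CS mult_left_mono[OF XJ]] by (simp add: power2_eq_square mult_ac)
    ultimately show ?thesis
      using ennreal_mult_le_mult_iff[of J J "ennreal (8 * pi) * G"]
      by (cases "J = 0") (auto simp: mult.commute)
  qed
  thus ?thesis unfolding JF G_def .
qed

section \<open>The Laplace transform on polar curves in L2\<close>

lemma nn_integral_exp_half_line:
  assumes "0 < a"
  shows "(\<integral>\<^sup>+ t. ennreal (exp (- a * t)) * indicator {0..} t \<partial>lborel) = ennreal (1 / a)"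
proof -
  have "(\<integral>\<^sup>+ t. ennreal (exp (- a * t)) * indicator {0..} t \<partial>lborel) = ennreal (0 - (- exp (- a * 0) / a))"
  proof (rule nn_integral_FTC_atLeast)
    show "((\<lambda>t. - exp (- a * t) / a) has_real_derivative exp (- a * t)) (at t)" for t
      using assms by (auto intro!: derivative_eq_intros)
    have "((\<lambda>t. - exp (- (a * t)) / a) \<longlongrightarrow> - 0 / a) at_top"
      using assms
      by (intro tendsto_divide tendsto_minus tendsto_const filterlim_compose[OF exp_at_bot]
          filterlim_compose[OF filterlim_uminus_at_bot_at_top]
          filterlim_tendsto_pos_mult_at_top[OF tendsto_const _ filterlim_ident]) auto
    thus "((\<lambda>t. - exp (- a * t) / a) \<longlongrightarrow> 0) at_top" by simp
  qed auto
  thus ?thesis by simp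
qed

lemma
  assumes "Re w < 0"
  shows set_integrable_exp_half_line: "set_integrable lborel {0<..} (\<lambda>t. exp (w * complex_of_real t))"
    and set_integral_exp_half_line: "(LBINT t:{0<..}. exp (w * complex_of_real t)) = - 1 / w"
proof -
  show I: "set_integrable lborel {0<..} (\<lambda>t. exp (w * complex_of_real t))"
    unfolding set_integrable_def
  proof (rule integrableI_bounded)
    have "(\<integral>\<^sup>+ t. ennreal (norm (indicat_real {0<..} t *\<^sub>R exp (w * complex_of_real t))) \<partial>lborel)
      \<le> (\<integral>\<^sup>+ t. ennreal (exp (- (- Re w) * t)) * indicator {0..} t \<partial>lborel)"
      by (intro nn_integral_mono) (auto simp: indicator_def)
    also have "\<dots> < \<infinity>" using assms by (subst nn_integral_exp_half_line) auto
    finally show "(\<integral>\<^sup>+ t. ennreal (norm (indicat_real {0<..} t *\<^sub>R exp (w * complex_of_real t))) \<partial>lborel) < \<infinity>" .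
  qed measurable
  have w: "w \<noteq> 0" using assms by auto
  have "(LBINT t=0..\<infinity>. exp (w * complex_of_real t)) = 0 - 1 / w"
  proof (rule interval_integral_FTC_integrable[where F = "\<lambda>t. exp (w * complex_of_real t) / w"])
    show "((\<lambda>t. exp (w * complex_of_real t) / w) has_vector_derivative exp (w * complex_of_real t)) (at t)" for t
      using w by (auto intro!: derivative_eq_intros has_vector_derivative_real_field)
    show "isCont (\<lambda>t. exp (w * complex_of_real t)) t" for t by (intro continuous_intros)
    show "set_integrable lborel (einterval 0 \<infinity>) (\<lambda>t. exp (w * complex_of_real t))"
      using I by (simp add: zero_ereal_def)
    have "((\<lambda>t. exp (w * complex_of_real t) / w) \<longlongrightarrow> exp (w * complex_of_real 0) / w) (at_right 0)"
      using w by (intro tendsto_intros) auto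
    thus "(((\<lambda>t. exp (w * complex_of_real t) / w) \<circ> real_of_ereal) \<longlongrightarrow> 1 / w) (at_right 0)"
      by (simp add: zero_ereal_def ereal_tendsto_simps1)
    have "((\<lambda>t. exp (w * complex_of_real t) / w) \<longlongrightarrow> 0) at_top"
    proof (rule tendsto_norm_zero_cancel)
      have "((\<lambda>t. exp (Re w * t) / norm w) \<longlongrightarrow> 0 / norm w) at_top"
        using assms w by (intro tendsto_divide tendsto_const filterlim_compose[OF exp_at_bot]
           filterlim_tendsto_neg_mult_at_bot[OF tendsto_const _ filterlim_ident]) auto
      thus "((\<lambda>t. norm (exp (w * complex_of_real t) / w)) \<longlongrightarrow> 0) at_top"
        by (simp add: norm_divide)
    qed
    thus "(((\<lambda>t. exp (w * complex_of_real t) / w) \<circ> real_of_ereal) \<longlongrightarrow> 0) (at_left \<infinity>)"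
      by (simp add: ereal_tendsto_simps1)
  qed auto
  thus "(LBINT t:{0<..}. exp (w * complex_of_real t)) = - 1 / w"
    by (simp add: interval_lebesgue_integral_def zero_ereal_def)
qed

text \<open>The two half-lines contribute 1 / (a - ib) and 1 / (a + ib), complex conjugates of each
  other. Either alone is a Cauchy kernel that is not of one sign; their sum is twice the common real
  part and hence positive.\<close>

lemma
  assumes "0 < a"
  shows integrable_exp_abs: "integrable lborel (\<lambda>t. exp (Complex (- a * \<bar>t\<bar>) (b * t)))"
    and integral_exp_abs: "(\<integral>t. exp (Complex (- a * \<bar>t\<bar>) (b * t)) \<partial>lborel) = complex_of_real (2 * poisson a b)"
proof -
  let ?E = "\<lambda>t. exp (Complex (- a * \<bar>t\<bar>) (b * t))"
  define h where "h b t = indicat_real {0<..} t *\<^sub>R exp (Complex (- a) b * complex_of_real t)" for b t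
  have h: "integrable lborel (h b)" "integral\<^sup>L lborel (h b) = - 1 / Complex (- a) b" for b
    using set_integrable_exp_half_line[of "Complex (- a) b"] set_integral_exp_half_line[of "Complex (- a) b"] assms
    by (simp_all add: h_def[abs_def] set_integrable_def set_lebesgue_integral_def)
  \<comment> \<open>At t = 0 both halves vanish while the exponential equals 1, so the identity
    holds only almost everywhere.\<close>
  have AE: "AE t in lborel. h b t + h (- b) (- t) = ?E t"
    using AE_lborel_singleton[of 0]
    by eventually_elim (auto simp: h_def indicator_def Complex_eq algebra_simps)
  have i2: "integrable lborel (\<lambda>t. h (- b) (- t))"
    using lborel_integrable_real_affine[OF h(1)[of "- b"], of "- 1" 0] by simp
  have e2: "(\<integral>t. h (- b) (- t) \<partial>lborel) = integral\<^sup>L lborel (h (- b))"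
    using lborel_integral_real_affine[of "- 1" "h (- b)" 0] by simp
  have m: "?E \<in> borel_measurable lborel" unfolding Complex_eq by measurable
  have hm: "(\<lambda>t. h b t + h (- b) (- t)) \<in> borel_measurable lborel"
    using h(1)[of b] i2 by (intro borel_measurable_add) auto
  show "integrable lborel ?E"
    using integrable_cong_AE[OF hm m AE] h(1) i2 by auto
  have "integral\<^sup>L lborel ?E = (\<integral>t. h b t + h (- b) (- t) \<partial>lborel)"
    using integral_cong_AE[OF hm m AE] by simp
  also have "\<dots> = - 1 / Complex (- a) b - 1 / Complex (- a) (- b)"
    using h(1) i2 by (simp add: e2 h(2))
  also have "\<dots> = complex_of_real (2 * poisson a b)"
    using assms by (auto simp: complex_eq_iff poisson_def Re_divide Im_divide power2_eq_square)
  finally show "integral\<^sup>L lborel ?E = complex_of_real (2 * poisson a b)" .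
qed

text \<open>
  In the upper quadrant \<open>0 \<le> \<bar>z\<bar> - Im z \<le> Re z\<close>, so that the heights may be replaced by the
  distances to the origin.
\<close>
lemma poisson_cone_le:
  assumes z: "norm z = r" "0 < Re z" "0 \<le> Im z" and w: "norm w = q" "0 < Re w" "0 \<le> Im w"
  shows "poisson (Re z + Re w) (Im z - Im w) \<le> 6 * (poisson (Re z) (r - q) + poisson (Re w) (r - q))"
proof -
  define m where "m = max (Re z) (Re w)"
  have m: "0 < m" "m \<le> Re z + Re w" "Re z + Re w \<le> 2 * m" using z w by (auto simp: m_def)
  have r: "0 \<le> r - Im z" "r - Im z \<le> Re z"
    using z abs_Im_le_cmod[of z] cmod_le[of z] by auto
  have q: "0 \<le> q - Im w" "q - Im w \<le> Re w"
    using w abs_Im_le_cmod[of w] cmod_le[of w] by auto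
  define d where "d = Im z - Im w"
  define D where "D = r - q"
  \<comment> \<open>Both r - Im z and q - Im w lie in [0, m], so they differ by at most m. Squaring
    yields the factor 3, and replacing the height Re z + Re w by m in the numerator yields the
    factor 2; together they make 6.\<close>
  have "\<bar>D\<bar> \<le> \<bar>d\<bar> + m" using r q unfolding D_def d_def m_def by linarith
  hence "D\<^sup>2 \<le> (\<bar>d\<bar> + m)\<^sup>2" by (metis abs_ge_zero abs_le_square_iff abs_of_nonneg order_trans)
  also have "\<dots> \<le> 2 * d\<^sup>2 + 2 * m\<^sup>2"
    using zero_le_power2[of "\<bar>d\<bar> - m"] by (simp add: power2_sum power2_diff)
  finally have D: "m\<^sup>2 + D\<^sup>2 \<le> 3 * (m\<^sup>2 + d\<^sup>2)" using zero_le_power2[of d]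
    unfolding distrib_left by linarith
  have pos: "0 < m\<^sup>2 + d\<^sup>2" "0 < m\<^sup>2 + D\<^sup>2" "0 < (Re z + Re w)\<^sup>2 + d\<^sup>2" using m by (auto intro!: add_pos_nonneg)
  have "poisson (Re z + Re w) d \<le> (2 * m) / (m\<^sup>2 + d\<^sup>2)"
    unfolding poisson_def using m pos by (intro frac_le) (auto intro!: power_mono)
  also have "\<dots> \<le> (2 * m) * (3 / (m\<^sup>2 + D\<^sup>2))"
  proof (rule order_trans[OF eq_refl mult_left_mono])
    show "2 * m / (m\<^sup>2 + d\<^sup>2) = 2 * m * (1 / (m\<^sup>2 + d\<^sup>2))" by simp
    show "1 / (m\<^sup>2 + d\<^sup>2) \<le> 3 / (m\<^sup>2 + D\<^sup>2)" using pos D by (simp add: field_simps)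
  qed (use m in simp)
  also have "\<dots> = 6 * poisson m D" by (simp add: poisson_def)
  also have "poisson m D \<le> poisson (Re z) D + poisson (Re w) D" using z w by (auto simp: m_def max_def)
  finally show ?thesis by (simp add: d_def D_def)
qed

section \<open>Integrability and Fubini tools\<close>

lemma measurable_cnj [measurable (raw)]:
  "f \<in> borel_measurable M \<Longrightarrow> (\<lambda>x. cnj (f x)) \<in> borel_measurable M"
  by (rule borel_measurable_continuous_on[OF continuous_on_cnj[OF continuous_on_id]])

text \<open>A non-integrable \<open>f\<close> has Bochner integral 0 by convention, which is below
  the integral of a nonnegative majorant. So only the majorant has to be checked for
  integrability.\<close>

lemma norm_integral_le:
  fixes f :: "'a \<Rightarrow> complex"
  assumes "integrable M g" "\<And>x. x \<in> space M \<Longrightarrow> norm (f x) \<le> g x"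
  shows "norm (integral\<^sup>L M f) \<le> integral\<^sup>L M g"
proof (cases "integrable M f")
  case True
  have "norm (integral\<^sup>L M f) \<le> (\<integral>x. norm (f x) \<partial>M)" by (rule integral_norm_bound)
  also have "\<dots> \<le> integral\<^sup>L M g" using True assms by (intro integral_mono) auto
  finally show ?thesis .
next
  case False
  have "0 \<le> integral\<^sup>L M g"
    using assms(2) norm_ge_zero order_trans by (intro Bochner_Integration.integral_nonneg) blast
  with False show ?thesis by (simp add: not_integrable_integral_eq)
qed

lemma integrable_mult_fst_snd:
  fixes u v :: "real \<Rightarrow> complex"
  assumes "integrable lborel u" "integrable lborel v"
  shows "integrable (lborel \<Otimes>\<^sub>M lborel) (\<lambda>(r, q). u r * v q)"
proof (rule lborel_pair.Fubini_integrable)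
  have [measurable]: "u \<in> borel_measurable borel" "v \<in> borel_measurable borel"
    using assms by (auto dest: borel_measurable_integrable)
  show "(\<lambda>(r, q). u r * v q) \<in> borel_measurable (lborel \<Otimes>\<^sub>M lborel)" by measurable
  show "integrable lborel (\<lambda>r. \<integral>q. norm (case (r, q) of (r, q) \<Rightarrow> u r * v q) \<partial>lborel)"
    using assms by (simp add: norm_mult)
  show "AE r in lborel. integrable lborel (\<lambda>q. case (r, q) of (r, q) \<Rightarrow> u r * v q)"
    using assms by simp
qed

lemma integrable_bounded_Icc:
  fixes g :: "real \<Rightarrow> complex"
  assumes "g \<in> borel_measurable borel" "\<And>r. norm (g r) \<le> b" "\<And>r. r \<notin> {c..d} \<Longrightarrow> g r = 0"
  shows "integrable lborel g"
proof (rule Bochner_Integration.integrable_bound)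
  show "integrable lborel (\<lambda>r. indicat_real {c..d} r * b)"
    using emeasure_lborel_Icc_eq[of c d] by (intro integrable_mult_left integrable_real_indicator) auto
  show "AE r in lborel. norm (g r) \<le> norm (indicat_real {c..d} r * b)"
    using assms(2,3) by (intro AE_I2) (auto simp: indicator_def intro: order_trans[OF _ abs_ge_self])
qed (use assms(1) in simp)

text \<open>The squared modulus of an integral over r is an integral over the plane of pairs (r, q).
  Exchanging it with the integral over t is Fubini's theorem for the line and the plane.\<close>

lemma pair_sigma_finite_lborel_pair:
  "pair_sigma_finite (lborel :: real measure) (lborel \<Otimes>\<^sub>M lborel :: (real \<times> real) measure)"
  unfolding lborel_prod by (rule pair_sigma_finite.intro) (rule sigma_finite_lborel)+

text \<open>
  For \<open>t \<ge> 0\<close>, \<open>H\<close> is the adjoint of \<open>\<phi> \<mapsto> (laplace \<phi>) \<circ> z\<close>. The even extension of the decaying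
  factor to \<open>t < 0\<close> turns the Cauchy kernel of \<open>\<parallel>H\<parallel>\<^sup>2\<close> into a positive one.
\<close>
lemma adjoint_laplace_L2_bound:
  fixes g z :: "real \<Rightarrow> complex"
  assumes [measurable]: "g \<in> borel_measurable borel" "z \<in> borel_measurable borel"
    and g: "\<And>r. norm (g r) \<le> b" "\<And>r. r \<notin> {c..d} \<Longrightarrow> g r = 0"
    and z: "\<And>r. g r \<noteq> 0 \<Longrightarrow> norm (z r) = r \<and> \<delta> \<le> Re (z r) \<and> 0 \<le> Im (z r)" and "0 < \<delta>"
  defines "H \<equiv> \<lambda>t. \<integral>r. g r * exp (Complex (- Re (z r) * \<bar>t\<bar>) (Im (z r) * t)) \<partial>lborel"
  shows "(\<integral>\<^sup>+ t. ennreal ((norm (H t))\<^sup>2) \<partial>lborel) \<le> ennreal (192 * pi) * (\<integral>\<^sup>+ r. ennreal ((norm (g r))\<^sup>2) \<partial>lborel)"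
proof -
  interpret P: pair_sigma_finite "lborel :: real measure" "lborel \<Otimes>\<^sub>M lborel :: (real \<times> real) measure"
    by (rule pair_sigma_finite_lborel_pair)
  define E where "E r t = exp (Complex (- Re (z r) * \<bar>t\<bar>) (Im (z r) * t))" for r t
  have Em [measurable]: "case_prod E \<in> borel_measurable (borel \<Otimes>\<^sub>M borel)"
    unfolding E_def Complex_eq by measurable
  have Em1 [measurable]: "(\<lambda>r. E r t) \<in> borel_measurable borel" for t
    unfolding E_def Complex_eq by measurable
  have gE: "norm (g r * E r t) \<le> exp (- \<delta> * \<bar>t\<bar>) * norm (g r)" for r t
  proof (cases "g r = 0")
    case False
    hence "\<delta> * \<bar>t\<bar> \<le> Re (z r) * \<bar>t\<bar>" using z by (intro mult_right_mono) auto
    hence "norm (E r t) \<le> exp (- \<delta> * \<bar>t\<bar>)" by (simp add: E_def)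
    from mult_right_mono[OF this, of "norm (g r)"] show ?thesis by (simp add: norm_mult mult.commute)
  qed simp
  have gi: "integrable lborel g" by (rule integrable_bounded_Icc[OF _ g]) simp
  have gEi: "integrable lborel (\<lambda>r. g r * E r t)" for t
  proof (rule Bochner_Integration.integrable_bound)
    show "integrable lborel (\<lambda>r. exp (- \<delta> * \<bar>t\<bar>) * norm (g r))" using gi by simp
    show "AE r in lborel. norm (g r * E r t) \<le> norm (exp (- \<delta> * \<bar>t\<bar>) * norm (g r))"
      using gE[of _ t] by simp
  qed measurable
  have gEc: "integrable lborel (\<lambda>r. cnj (g r * E r t))" for t
    using gEi[of t] by (rule integrable_cnj)
  \<comment> \<open>Integrating over the pair (r, q) gives the squared modulus of
    \<open>H t\<close>; integrating over \<open>t\<close> gives the Poisson kernel. The factor exp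
    (- 2 \<delta> |t|) makes the triple integral absolutely convergent.\<close>
  define \<Psi> where "\<Psi> = (\<lambda>(t, r, q). (g r * E r t) * cnj (g q * E q t))"
  have \<Psi>m [measurable]: "\<Psi> \<in> borel_measurable (lborel \<Otimes>\<^sub>M lborel \<Otimes>\<^sub>M lborel)"
    unfolding \<Psi>_def E_def Complex_eq by measurable
  have \<Psi>i: "integrable (lborel \<Otimes>\<^sub>M lborel \<Otimes>\<^sub>M lborel) \<Psi>"
  proof (rule P.Fubini_integrable[OF \<Psi>m])
    have gg: "integrable (lborel \<Otimes>\<^sub>M lborel) (\<lambda>(r, q). (g r * E r t) * cnj (g q * E q t))" for t
      by (intro integrable_mult_fst_snd gEi gEc)
    thus "AE t in lborel. integrable (lborel \<Otimes>\<^sub>M lborel) (\<lambda>y. \<Psi> (t, y))"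
      by (simp add: \<Psi>_def case_prod_unfold)
    have gn: "integrable (lborel \<Otimes>\<^sub>M lborel) (\<lambda>(r, q). norm (g r) * norm (g q))"
      using integrable_norm[OF integrable_mult_fst_snd[OF gi gi]] by (simp add: case_prod_unfold norm_mult)
    define C where "C = (\<integral>y. norm (g (fst y)) * norm (g (snd y)) \<partial>(lborel \<Otimes>\<^sub>M lborel))"
    show "integrable lborel (\<lambda>t. \<integral>y. norm (\<Psi> (t, y)) \<partial>(lborel \<Otimes>\<^sub>M lborel))"
    proof (rule Bochner_Integration.integrable_bound)
      \<comment> \<open>At frequency 0 the exponential is its own norm, so the Fourier lemma also
        supplies the integrability of the majorant.\<close>
      have "integrable lborel (\<lambda>t. norm (exp (Complex (- (2 * \<delta>) * \<bar>t\<bar>) (0 * t))) * C)"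
        using integrable_exp_abs[of "2 * \<delta>" 0] \<open>0 < \<delta>\<close>
        by (intro integrable_mult_left integrable_norm) simp
      thus "integrable lborel (\<lambda>t. exp (- (2 * \<delta>) * \<bar>t\<bar>) * C)" by simp
      show "AE t in lborel. norm (\<integral>y. norm (\<Psi> (t, y)) \<partial>(lborel \<Otimes>\<^sub>M lborel)) \<le> norm (exp (- (2 * \<delta>) * \<bar>t\<bar>) * C)"
      proof (intro AE_I2)
        fix t
        have "(\<integral>y. norm (\<Psi> (t, y)) \<partial>(lborel \<Otimes>\<^sub>M lborel)) \<le>
          (\<integral>y. exp (- (2 * \<delta>) * \<bar>t\<bar>) * (norm (g (fst y)) * norm (g (snd y))) \<partial>(lborel \<Otimes>\<^sub>M lborel))"
        proof (rule integral_mono)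
          show "integrable (lborel \<Otimes>\<^sub>M lborel) (\<lambda>y. norm (\<Psi> (t, y)))"
            using gg[of t] by (intro integrable_norm) (simp add: \<Psi>_def case_prod_unfold)
          show "integrable (lborel \<Otimes>\<^sub>M lborel) (\<lambda>y. exp (- (2 * \<delta>) * \<bar>t\<bar>) * (norm (g (fst y)) * norm (g (snd y))))"
            using gn by (simp add: case_prod_unfold)
          fix y :: "real \<times> real"
          have "norm (\<Psi> (t, y)) \<le> (exp (- \<delta> * \<bar>t\<bar>) * norm (g (fst y))) * (exp (- \<delta> * \<bar>t\<bar>) * norm (g (snd y)))"
            using mult_mono[OF gE[of "fst y" t] gE[of "snd y" t]] by (simp add: \<Psi>_def case_prod_unfold norm_mult)
          also have "\<dots> = exp (- (2 * \<delta>) * \<bar>t\<bar>) * (norm (g (fst y)) * norm (g (snd y)))"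
            by (simp add: mult_ac flip: exp_add)
          finally show "norm (\<Psi> (t, y)) \<le> exp (- (2 * \<delta>) * \<bar>t\<bar>) * (norm (g (fst y)) * norm (g (snd y)))" .
        qed
        also have "\<dots> = exp (- (2 * \<delta>) * \<bar>t\<bar>) * C" by (simp add: C_def)
        finally show "norm (\<integral>y. norm (\<Psi> (t, y)) \<partial>(lborel \<Otimes>\<^sub>M lborel)) \<le> norm (exp (- (2 * \<delta>) * \<bar>t\<bar>) * C)"
          by (auto intro: order_trans[OF _ abs_ge_self])
      qed
    qed measurable
  qed
  have HE: "H t = (\<integral>r. g r * E r t \<partial>lborel)" for t by (simp add: H_def E_def)
  have inner: "(\<integral>y. \<Psi> (t, y) \<partial>(lborel \<Otimes>\<^sub>M lborel)) = complex_of_real ((norm (H t))\<^sup>2)" for t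
  proof -
    have "integrable (lborel \<Otimes>\<^sub>M lborel) (\<lambda>(r, q). (g r * E r t) * cnj (g q * E q t))"
      by (intro integrable_mult_fst_snd gEi gEc)
    from lborel_pair.integral_fst[OF this]
    have "(\<integral>y. \<Psi> (t, y) \<partial>(lborel \<Otimes>\<^sub>M lborel)) = (\<integral>r. \<integral>q. (g r * E r t) * cnj (g q * E q t) \<partial>lborel \<partial>lborel)"
      by (simp add: \<Psi>_def case_prod_unfold)
    also have "\<dots> = (\<integral>r. (g r * E r t) * cnj (H t) \<partial>lborel)"
      unfolding HE using gEi[of t] by (simp add: integral_mult_right_zero del: complex_cnj_mult)
    also have "\<dots> = H t * cnj (H t)" unfolding HE by (rule integral_mult_left_zero)
    finally show ?thesis by (simp add: complex_norm_square[symmetric])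
  qed
  have "integrable lborel (\<lambda>t. complex_of_real ((norm (H t))\<^sup>2))"
    using P.integrable_fst'[OF \<Psi>i] by (simp add: inner)
  hence Hi: "integrable lborel (\<lambda>t. (norm (H t))\<^sup>2)"
    by (simp only: complex_of_real_integrable_eq)
  define F where "F = (\<lambda>(r, q). norm (g r) * norm (g q) * (2 * poisson (Re (z r) + Re (z q)) (Im (z r) - Im (z q))))"
  have tint: "(\<integral>t. \<Psi> (t, (r, q)) \<partial>lborel) =
      g r * cnj (g q) * complex_of_real (2 * poisson (Re (z r) + Re (z q)) (Im (z r) - Im (z q)))" for r q
  proof (cases "g r = 0 \<or> g q = 0")
    case False
    hence p: "0 < Re (z r) + Re (z q)" using z[of r] z[of q] \<open>0 < \<delta>\<close> by auto
    have "\<Psi> (t, (r, q)) = g r * cnj (g q) *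
      exp (Complex (- (Re (z r) + Re (z q)) * \<bar>t\<bar>) ((Im (z r) - Im (z q)) * t))" for t
    proof -
      have "E r t * cnj (E q t) = exp (Complex (- (Re (z r) + Re (z q)) * \<bar>t\<bar>) ((Im (z r) - Im (z q)) * t))"
        unfolding E_def exp_cnj exp_add[symmetric]
        by (intro arg_cong[where f = exp]) (simp add: complex_eq_iff algebra_simps)
      thus ?thesis by (simp add: \<Psi>_def mult_ac)
    qed
    thus ?thesis using integral_exp_abs[OF p] by simp
  qed (auto simp: \<Psi>_def)
  have "complex_of_real (\<integral>t. (norm (H t))\<^sup>2 \<partial>lborel) = (\<integral>t. \<integral>y. \<Psi> (t, y) \<partial>(lborel \<Otimes>\<^sub>M lborel) \<partial>lborel)"
    unfolding inner by (rule integral_complex_of_real[symmetric])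
  also have "\<dots> = (\<integral>y. \<integral>t. \<Psi> (t, y) \<partial>lborel \<partial>(lborel \<Otimes>\<^sub>M lborel))"
    using P.Fubini_integral[of "\<lambda>t y. \<Psi> (t, y)"] \<Psi>i by simp
  finally have eq: "complex_of_real (\<integral>t. (norm (H t))\<^sup>2 \<partial>lborel) = (\<integral>y. \<integral>t. \<Psi> (t, y) \<partial>lborel \<partial>(lborel \<Otimes>\<^sub>M lborel))" .
  have int2: "integrable (lborel \<Otimes>\<^sub>M lborel) (\<lambda>y. \<integral>t. \<Psi> (t, y) \<partial>lborel)"
    using P.integrable_snd[of "\<lambda>t y. \<Psi> (t, y)"] \<Psi>i by simp
  have "(\<integral>\<^sup>+ t. ennreal ((norm (H t))\<^sup>2) \<partial>lborel) = ennreal (\<integral>t. (norm (H t))\<^sup>2 \<partial>lborel)"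
    by (rule nn_integral_eq_integral[OF Hi]) simp
  also have "\<dots> = ennreal (norm (complex_of_real (\<integral>t. (norm (H t))\<^sup>2 \<partial>lborel)))"
    by simp
  \<comment> \<open>Absolute values enter only after the integration over t, so the decay in the
    difference of the imaginary parts survives. The kernel being positive, the moduli fall on
    \<open>g\<close> alone.\<close>
  also have "\<dots> \<le> (\<integral>\<^sup>+ y. ennreal (norm (\<integral>t. \<Psi> (t, y) \<partial>lborel)) \<partial>(lborel \<Otimes>\<^sub>M lborel))"
    unfolding eq by (rule integral_norm_bound_ennreal[OF int2])
  also have "\<dots> = (\<integral>\<^sup>+ y. ennreal (F y) \<partial>(lborel \<Otimes>\<^sub>M lborel))"
  proof (intro nn_integral_cong)
    fix y :: "real \<times> real"
    have "0 \<le> F y" using z[of "fst y"] z[of "snd y"] \<open>0 < \<delta>\<close>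
      by (cases "g (fst y) = 0 \<or> g (snd y) = 0") (auto simp: F_def case_prod_unfold)
    moreover have "norm (\<integral>t. \<Psi> (t, y) \<partial>lborel) = \<bar>F y\<bar>"
      by (cases y) (simp add: tint norm_mult F_def abs_mult)
    ultimately show "ennreal (norm (\<integral>t. \<Psi> (t, y) \<partial>lborel)) = ennreal (F y)" by simp
  qed
  also have "\<dots> = (\<integral>\<^sup>+ r. \<integral>\<^sup>+ q. ennreal (F (r, q)) \<partial>lborel \<partial>lborel)"
    by (subst lborel.nn_integral_fst) (auto simp: F_def)
  \<comment> \<open>12 is the factor 2 in \<open>F\<close> times the 6 of
    \<open>poisson_cone_le\<close>. The second term is written so that it becomes the first one when
    r and q are exchanged.\<close>
  also have "\<dots> \<le> (\<integral>\<^sup>+ r. \<integral>\<^sup>+ q. ennreal 12 * (ennreal (norm (g r)) * ennreal (norm (g q)) * ennreal (poisson (Re (z r)) (r - q))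
     + ennreal (norm (g q)) * ennreal (norm (g r)) * ennreal (poisson (Re (z q)) (q - r))) \<partial>lborel \<partial>lborel)"
  proof (intro nn_integral_mono)
    fix r q
    show "ennreal (F (r, q)) \<le> ennreal 12 * (ennreal (norm (g r)) * ennreal (norm (g q)) * ennreal (poisson (Re (z r)) (r - q))
     + ennreal (norm (g q)) * ennreal (norm (g r)) * ennreal (poisson (Re (z q)) (q - r)))"
    proof (cases "g r = 0 \<or> g q = 0")
      case False
      hence "poisson (Re (z r) + Re (z q)) (Im (z r) - Im (z q)) \<le> 6 * (poisson (Re (z r)) (r - q) + poisson (Re (z q)) (r - q))"
        using z[of r] z[of q] \<open>0 < \<delta>\<close> by (intro poisson_cone_le) auto
      from mult_left_mono[OF this, of "2 * norm (g r) * norm (g q)"]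
      have "F (r, q) \<le> 12 * (norm (g r) * norm (g q) * poisson (Re (z r)) (r - q) + norm (g q) * norm (g r) * poisson (Re (z q)) (q - r))"
        using poisson_minus[of "Re (z q)" "q - r"] by (simp add: F_def algebra_simps)
      moreover have "0 \<le> poisson (Re (z r)) (r - q)" "0 \<le> poisson (Re (z q)) (q - r)"
        using False z[of r] z[of q] \<open>0 < \<delta>\<close> by auto
      ultimately show ?thesis by (simp flip: ennreal_mult' ennreal_plus add: ennreal_leI del: ennreal_numeral)
    qed (auto simp: F_def)
  qed
  also have "\<dots> = ennreal 12 * ((\<integral>\<^sup>+ r. \<integral>\<^sup>+ q. ennreal (norm (g r)) * ennreal (norm (g q)) * ennreal (poisson (Re (z r)) (r - q)) \<partial>lborel \<partial>lborel)
     + (\<integral>\<^sup>+ r. \<integral>\<^sup>+ q. ennreal (norm (g q)) * ennreal (norm (g r)) * ennreal (poisson (Re (z q)) (q - r)) \<partial>lborel \<partial>lborel))"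
    by (simp add: nn_integral_cmult nn_integral_add)
  also have "(\<integral>\<^sup>+ r. \<integral>\<^sup>+ q. ennreal (norm (g q)) * ennreal (norm (g r)) * ennreal (poisson (Re (z q)) (q - r)) \<partial>lborel \<partial>lborel) =
    (\<integral>\<^sup>+ r. \<integral>\<^sup>+ q. ennreal (norm (g r)) * ennreal (norm (g q)) * ennreal (poisson (Re (z r)) (r - q)) \<partial>lborel \<partial>lborel)"
    by (rule lborel_pair.Fubini') measurable
  also have "ennreal 12 * (\<dots> + \<dots>) = ennreal 24 * \<dots>"
    by (simp add: mult_2[symmetric] flip: mult.assoc)
  also have "\<dots> \<le> ennreal 24 * (ennreal (8 * pi) * (\<integral>\<^sup>+ r. ennreal ((norm (g r))\<^sup>2) \<partial>lborel))"
    using g z \<open>0 < \<delta>\<close> by (intro mult_left_mono poisson_form_bound[where b = b and c = c and d = d and \<delta> = \<delta>]) auto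
  also have "\<dots> = ennreal (192 * pi) * (\<integral>\<^sup>+ r. ennreal ((norm (g r))\<^sup>2) \<partial>lborel)"
    by (simp add: mult.assoc[symmetric] ennreal_mult'[symmetric] del: ennreal_numeral)
  finally show ?thesis .
qed

text \<open>Duality with the extremal test function: \<open>g\<close> is the transform itself, cut
  off to \<open>E\<close>. Pairing gives G = \<integral> \<phi> cnj H, so Cauchy--Schwarz and the
  adjoint bound yield G^2 \<le> F * 192 pi * G, and one factor G cancels because it is
  finite.\<close>

lemma laplace_L2_upper:
  fixes \<phi> z :: "real \<Rightarrow> complex"
  assumes [measurable]: "\<phi> \<in> borel_measurable borel" "z \<in> borel_measurable borel" "E \<in> sets borel"
    and \<phi>: "\<And>t. norm (\<phi> t) \<le> K" "\<And>t. t \<notin> {0..n} \<Longrightarrow> \<phi> t = 0"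
    and E: "E \<subseteq> {c..d}" and z: "\<And>r. r \<in> E \<Longrightarrow> norm (z r) = r \<and> \<delta> \<le> Re (z r) \<and> 0 \<le> Im (z r)" and "0 < \<delta>"
  shows "(\<integral>\<^sup>+ r. ennreal ((norm (\<integral>t. \<phi> t * exp (- (z r * complex_of_real t)) \<partial>lborel))\<^sup>2) * indicator E r \<partial>lborel)
    \<le> ennreal (192 * pi) * (\<integral>\<^sup>+ t. ennreal ((norm (\<phi> t))\<^sup>2) \<partial>lborel)"
proof -
  define u where "u r = (\<integral>t. \<phi> t * exp (- (z r * complex_of_real t)) \<partial>lborel)" for r
  have [measurable]: "u \<in> borel_measurable borel" unfolding u_def by measurable
  have \<phi>i: "integrable lborel \<phi>" by (rule integrable_bounded_Icc[OF _ \<phi>]) simp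
  define K' where "K' = (\<integral>t. norm (\<phi> t) \<partial>lborel)"
  have bd: "norm (\<phi> t * exp (- (z r * complex_of_real t))) \<le> norm (\<phi> t)" if "r \<in> E" for r t
  proof (cases "\<phi> t = 0")
    case False
    hence "0 \<le> t" using \<phi>(2)[of t] by force
    moreover have "0 \<le> Re (z r)" using z[OF that] \<open>0 < \<delta>\<close> by simp
    ultimately have "norm (exp (- (z r * complex_of_real t))) \<le> 1" by simp
    from mult_left_mono[OF this, of "norm (\<phi> t)"] show ?thesis by (simp add: norm_mult)
  qed simp
  have uK: "norm (u r) \<le> K'" if "r \<in> E" for r
    unfolding u_def K'_def
    using bd[OF that] \<phi>i by (intro norm_integral_le) auto
  define g where "g r = indicat_real E r *\<^sub>R u r" for r
  have [measurable]: "g \<in> borel_measurable borel" unfolding g_def by measurable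
  have K': "0 \<le> K'" by (simp add: K'_def)
  have gK: "norm (g r) \<le> K'" "r \<notin> {c..d} \<Longrightarrow> g r = 0" for r
    using uK[of r] K' E by (auto simp: g_def indicator_def)
  have gz: "norm (z r) = r \<and> \<delta> \<le> Re (z r) \<and> 0 \<le> Im (z r)" if "g r \<noteq> 0" for r
    using that by (intro z) (auto simp: g_def indicator_def split: if_splits)
  have gi: "integrable lborel g" by (rule integrable_bounded_Icc[OF _ gK]) simp
  define H where "H t = (\<integral>r. g r * exp (Complex (- Re (z r) * \<bar>t\<bar>) (Im (z r) * t)) \<partial>lborel)" for t
  have [measurable]: "H \<in> borel_measurable borel" unfolding H_def Complex_eq by measurable
  define G where "G = (\<integral>\<^sup>+ r. ennreal ((norm (g r))\<^sup>2) \<partial>lborel)"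
  define F where "F = (\<integral>\<^sup>+ t. ennreal ((norm (\<phi> t))\<^sup>2) \<partial>lborel)"
  have HG: "(\<integral>\<^sup>+ t. ennreal ((norm (H t))\<^sup>2) \<partial>lborel) \<le> ennreal (192 * pi) * G"
    unfolding H_def G_def by (rule adjoint_laplace_L2_bound[OF _ _ gK gz \<open>0 < \<delta>\<close>]) simp_all
  have g2i: "integrable lborel (\<lambda>r. cnj (g r) * g r)"
  proof (rule integrable_bounded_Icc)
    show "norm (cnj (g r) * g r) \<le> K' * K'" for r
      using gK(1)[of r] K' by (auto simp: norm_mult intro!: mult_mono)
    show "cnj (g r) * g r = 0" if "r \<notin> {c..d}" for r using gK(2)[OF that] by simp
  qed measurable
  have c2: "cnj (g r) * g r = complex_of_real ((norm (g r))\<^sup>2)" for r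
    by (simp add: complex_norm_square[symmetric] mult.commute)
  have Gi: "integrable lborel (\<lambda>r. (norm (g r))\<^sup>2)"
    using g2i unfolding c2 by (simp only: complex_of_real_integrable_eq)
  have Gfin: "G < \<infinity>" unfolding G_def using nn_integral_eq_integral[OF Gi] by simp
  define \<Psi> where "\<Psi> = (\<lambda>(r, t). cnj (g r) * (\<phi> t * exp (- (z r * complex_of_real t))))"
  have \<Psi>i: "integrable (lborel \<Otimes>\<^sub>M lborel) \<Psi>"
  proof (rule Bochner_Integration.integrable_bound)
    show "integrable (lborel \<Otimes>\<^sub>M lborel) (\<lambda>(r, t). g r * \<phi> t)"
      by (rule integrable_mult_fst_snd[OF gi \<phi>i])
    have "norm (\<Psi> (r, t)) \<le> norm (g r * \<phi> t)" for r t
    proof (cases "r \<in> E")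
      case True
      from mult_left_mono[OF bd[OF this], of "norm (g r)"] show ?thesis
        by (simp add: \<Psi>_def norm_mult)
    qed (simp add: \<Psi>_def g_def)
    thus "AE y in lborel \<Otimes>\<^sub>M lborel. norm (\<Psi> y) \<le> norm (case y of (r, t) \<Rightarrow> g r * \<phi> t)" by auto
  qed (simp add: \<Psi>_def)
  have "complex_of_real (\<integral>r. (norm (g r))\<^sup>2 \<partial>lborel) = (\<integral>r. cnj (g r) * g r \<partial>lborel)"
    unfolding c2 by (rule integral_complex_of_real[symmetric])
  also have "\<dots> = (\<integral>r. \<integral>t. \<Psi> (r, t) \<partial>lborel \<partial>lborel)"
    by (intro Bochner_Integration.integral_cong) (auto simp: \<Psi>_def g_def u_def indicator_def)
  also have "\<dots> = (\<integral>t. \<integral>r. \<Psi> (r, t) \<partial>lborel \<partial>lborel)"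
    using lborel_pair.Fubini_integral[of "\<lambda>r t. \<Psi> (r, t)"] \<Psi>i by simp
  also have "\<dots> = (\<integral>t. \<phi> t * cnj (H t) \<partial>lborel)"
  proof (intro Bochner_Integration.integral_cong refl)
    fix t
    show "(\<integral>r. \<Psi> (r, t) \<partial>lborel) = \<phi> t * cnj (H t)"
    proof (cases "\<phi> t = 0")
      case False
      hence t: "0 \<le> t" using \<phi>(2)[of t] by force
      have "\<Psi> (r, t) = \<phi> t * cnj (g r * exp (Complex (- Re (z r) * \<bar>t\<bar>) (Im (z r) * t)))" for r
      proof -
        \<comment> \<open>For t \<ge> 0 the even extension changes nothing, and the conjugate of the
          exponent in \<open>H\<close> is the Laplace exponent. The support of \<phi> restricts the
          pairing to this range.\<close>
        have "cnj (Complex (- Re (z r) * \<bar>t\<bar>) (Im (z r) * t)) = - (z r * complex_of_real t)"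
          using t by (simp add: complex_eq_iff)
        thus ?thesis by (simp add: \<Psi>_def exp_cnj)
      qed
      hence "(\<integral>r. \<Psi> (r, t) \<partial>lborel) = (\<integral>r. \<phi> t * cnj (g r * exp (Complex (- Re (z r) * \<bar>t\<bar>) (Im (z r) * t))) \<partial>lborel)"
        by simp
      thus ?thesis unfolding H_def Bochner_Integration.integral_cnj[symmetric] by (simp only: integral_mult_right_zero)
    qed (simp add: \<Psi>_def)
  qed
  finally have eq: "complex_of_real (\<integral>r. (norm (g r))\<^sup>2 \<partial>lborel) = (\<integral>t. \<phi> t * cnj (H t) \<partial>lborel)" .
  have \<phi>Hi: "integrable lborel (\<lambda>t. \<phi> t * cnj (H t))"
  proof (rule Bochner_Integration.integrable_bound)
    show "integrable lborel (\<lambda>t. norm (\<phi> t) * (\<integral>r. norm (g r) \<partial>lborel))" using \<phi>i by simp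
    show "AE t in lborel. norm (\<phi> t * cnj (H t)) \<le> norm (norm (\<phi> t) * (\<integral>r. norm (g r) \<partial>lborel))"
    proof (intro AE_I2)
      fix t
      have "norm (H t) \<le> (\<integral>r. norm (g r) \<partial>lborel)" unfolding H_def
      proof (rule norm_integral_le)
        fix r show "norm (g r * exp (Complex (- Re (z r) * \<bar>t\<bar>) (Im (z r) * t))) \<le> norm (g r)"
        proof (cases "g r = 0")
          case False
          hence "0 \<le> Re (z r) * \<bar>t\<bar>" using gz[of r] \<open>0 < \<delta>\<close> by simp
          thus ?thesis using mult_left_mono[of "exp (- (Re (z r) * \<bar>t\<bar>))" 1 "norm (g r)"] by (simp add: norm_mult)
        qed simp
      qed (use gi in auto)
      thus "norm (\<phi> t * cnj (H t)) \<le> norm (norm (\<phi> t) * (\<integral>r. norm (g r) \<partial>lborel))"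
        by (auto simp: norm_mult abs_mult intro!: mult_left_mono)
    qed
  qed measurable
  have "G = ennreal (\<integral>r. (norm (g r))\<^sup>2 \<partial>lborel)" unfolding G_def by (rule nn_integral_eq_integral[OF Gi]) simp
  also have "\<dots> = ennreal (norm (complex_of_real (\<integral>r. (norm (g r))\<^sup>2 \<partial>lborel)))" by simp
  also have "\<dots> \<le> (\<integral>\<^sup>+ t. ennreal (norm (\<phi> t * cnj (H t))) \<partial>lborel)"
    unfolding eq by (rule integral_norm_bound_ennreal[OF \<phi>Hi])
  also have "\<dots> = (\<integral>\<^sup>+ t. ennreal (norm (\<phi> t)) * ennreal (norm (H t)) \<partial>lborel)"
    by (simp add: norm_mult ennreal_mult)
  finally have "G\<^sup>2 \<le> (\<integral>\<^sup>+ t. ennreal (norm (\<phi> t)) * ennreal (norm (H t)) \<partial>lborel)\<^sup>2"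
    by (simp add: power_mono)
  also have "\<dots> \<le> (\<integral>\<^sup>+ t. ennreal (norm (\<phi> t)) ^ 2 \<partial>lborel) * (\<integral>\<^sup>+ t. ennreal (norm (H t)) ^ 2 \<partial>lborel)"
    by (rule Cauchy_Schwarz_nn_integral) measurable
  also have "\<dots> = F * (\<integral>\<^sup>+ t. ennreal ((norm (H t))\<^sup>2) \<partial>lborel)" by (simp add: F_def ennreal_power)
  also have "\<dots> \<le> F * (ennreal (192 * pi) * G)" by (intro mult_left_mono HG) simp
  finally have "G * G \<le> G * (ennreal (192 * pi) * F)" by (simp add: power2_eq_square mult_ac)
  hence "G \<le> ennreal (192 * pi) * F"
    using Gfin ennreal_mult_le_mult_iff[of G G "ennreal (192 * pi) * F"] by (cases "G = 0") auto
  moreover have "G = (\<integral>\<^sup>+ r. ennreal ((norm (u r))\<^sup>2) * indicator E r \<partial>lborel)"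
    unfolding G_def by (intro nn_integral_cong) (auto simp: g_def indicator_def)
  ultimately show ?thesis unfolding u_def F_def by simp
qed

text \<open>Conjugation reflects the lower quadrant into the upper one: the conjugate of the
  transform of \<phi> at z is the transform of cnj \<phi> at cnj z, and cnj \<phi> has the same
  norm. The two parts of the curve contribute 192 pi each.\<close>

lemma laplace_L2_bound:
  fixes \<phi> z :: "real \<Rightarrow> complex"
  assumes [measurable]: "\<phi> \<in> borel_measurable borel" "z \<in> borel_measurable borel" "E \<in> sets borel"
    and \<phi>: "\<And>t. norm (\<phi> t) \<le> K" "\<And>t. t \<notin> {0..n} \<Longrightarrow> \<phi> t = 0"
    and E: "E \<subseteq> {c..d}" and z: "\<And>r. r \<in> E \<Longrightarrow> norm (z r) = r \<and> \<delta> \<le> Re (z r)" and "0 < \<delta>"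
  shows "(\<integral>\<^sup>+ r. ennreal ((norm (\<integral>t. \<phi> t * exp (- (z r * complex_of_real t)) \<partial>lborel))\<^sup>2) * indicator E r \<partial>lborel)
    \<le> ennreal (384 * pi) * (\<integral>\<^sup>+ t. ennreal ((norm (\<phi> t))\<^sup>2) \<partial>lborel)"
proof -
  define u where "u r = (\<integral>t. \<phi> t * exp (- (z r * complex_of_real t)) \<partial>lborel)" for r
  have [measurable]: "u \<in> borel_measurable borel" unfolding u_def by measurable
  define E1 where "E1 = E \<inter> {r \<in> space borel. 0 \<le> Im (z r)}"
  define E2 where "E2 = E \<inter> {r \<in> space borel. Im (z r) \<le> 0}"
  have [measurable]: "E1 \<in> sets borel" "E2 \<in> sets borel" unfolding E1_def E2_def by measurable
  have u2: "norm (u r) = norm (\<integral>t. cnj (\<phi> t) * exp (- (cnj (z r) * complex_of_real t)) \<partial>lborel)" for r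
  proof -
    have "(\<integral>t. cnj (\<phi> t) * exp (- (cnj (z r) * complex_of_real t)) \<partial>lborel) = cnj (u r)"
      unfolding u_def by (simp add: exp_cnj flip: Bochner_Integration.integral_cnj)
    thus ?thesis by simp
  qed
  have "(\<integral>\<^sup>+ r. ennreal ((norm (u r))\<^sup>2) * indicator E r \<partial>lborel) \<le>
     (\<integral>\<^sup>+ r. ennreal ((norm (u r))\<^sup>2) * indicator E1 r + ennreal ((norm (u r))\<^sup>2) * indicator E2 r \<partial>lborel)"
    by (intro nn_integral_mono) (auto simp: E1_def E2_def indicator_def)
  also have "\<dots> = (\<integral>\<^sup>+ r. ennreal ((norm (u r))\<^sup>2) * indicator E1 r \<partial>lborel) +
      (\<integral>\<^sup>+ r. ennreal ((norm (u r))\<^sup>2) * indicator E2 r \<partial>lborel)"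
    by (rule nn_integral_add) measurable
  also have "\<dots> \<le> ennreal (192 * pi) * (\<integral>\<^sup>+ t. ennreal ((norm (\<phi> t))\<^sup>2) \<partial>lborel)
      + ennreal (192 * pi) * (\<integral>\<^sup>+ t. ennreal ((norm (cnj (\<phi> t)))\<^sup>2) \<partial>lborel)"
  proof (rule add_mono)
    show "(\<integral>\<^sup>+ r. ennreal ((norm (u r))\<^sup>2) * indicator E1 r \<partial>lborel) \<le> ennreal (192 * pi) * (\<integral>\<^sup>+ t. ennreal ((norm (\<phi> t))\<^sup>2) \<partial>lborel)"
      unfolding u_def using E z
      by (intro laplace_L2_upper[OF _ _ _ \<phi> _ _ \<open>0 < \<delta>\<close>, where c = c and d = d]) (auto simp: E1_def)
    show "(\<integral>\<^sup>+ r. ennreal ((norm (u r))\<^sup>2) * indicator E2 r \<partial>lborel) \<le> ennreal (192 * pi) * (\<integral>\<^sup>+ t. ennreal ((norm (cnj (\<phi> t)))\<^sup>2) \<partial>lborel)"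
      unfolding u2 using E z \<phi>
      by (intro laplace_L2_upper[OF _ _ _ _ _ _ _ \<open>0 < \<delta>\<close>, where c = c and d = d and K = K and n = n]) (auto simp: E2_def)
  qed
  also have "\<dots> = ennreal (384 * pi) * (\<integral>\<^sup>+ t. ennreal ((norm (\<phi> t))\<^sup>2) \<partial>lborel)"
    by (simp add: distrib_right[symmetric] flip: ennreal_plus)
  finally show ?thesis unfolding u_def .
qed

section \<open>Interpolation\<close>

text \<open>Because \<open>h\<close> is bounded, the exponential series may be integrated term by
  term, with majorants |w| (|\<zeta>| |B|)^n / n!. The result is a power series in \<zeta> that
  converges everywhere.\<close>

lemma holomorphic_integral_exp:
  fixes w :: "'a \<Rightarrow> complex" and h :: "'a \<Rightarrow> real"
  assumes w: "integrable M w" and [measurable]: "h \<in> borel_measurable M"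
    and h: "\<And>x. x \<in> space M \<Longrightarrow> \<bar>h x\<bar> \<le> B"
  shows "(\<lambda>\<zeta>. \<integral>x. w x * exp (\<zeta> * complex_of_real (h x)) \<partial>M) holomorphic_on UNIV"
proof -
  have [measurable]: "w \<in> borel_measurable M" using w by (rule borel_measurable_integrable)
  define c where "c n = (\<integral>x. w x * (complex_of_real (h x) ^ n / fact n) \<partial>M)" for n
  have sums: "(\<lambda>n. c n * \<zeta> ^ n) sums (\<integral>x. w x * exp (\<zeta> * complex_of_real (h x)) \<partial>M)" for \<zeta> :: complex
  proof -
    define u where "u n x = w x * ((\<zeta> * complex_of_real (h x)) ^ n / fact n)" for n x
    have un: "norm (u n x) \<le> norm (w x) * ((norm \<zeta> * \<bar>B\<bar>) ^ n / fact n)" if "x \<in> space M" for n x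
      unfolding u_def norm_mult norm_divide norm_power norm_fact using h[OF that]
      by (intro mult_left_mono divide_right_mono power_mono mult_nonneg_nonneg) auto
    have ui: "integrable M (u n)" for n
    proof (rule Bochner_Integration.integrable_bound)
      show "integrable M (\<lambda>x. norm (w x) * ((norm \<zeta> * \<bar>B\<bar>) ^ n / fact n))" using w by simp
      show "AE x in M. norm (u n x) \<le> norm (norm (w x) * ((norm \<zeta> * \<bar>B\<bar>) ^ n / fact n))"
        using un[of _ n] by (intro AE_I2) (auto intro: order_trans[OF _ abs_ge_self])
    qed (simp add: u_def[abs_def])
    have exps: "summable (\<lambda>n. r ^ n / fact n)" for r :: real
      using summable_exp[of r] by (simp add: divide_inverse mult.commute)
    have s1: "(\<lambda>n. u n x) sums (w x * exp (\<zeta> * complex_of_real (h x)))" for x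
      unfolding u_def using exp_converges[of "\<zeta> * complex_of_real (h x)"]
      by (intro sums_mult) (simp add: scaleR_conv_of_real divide_inverse mult.commute)
    have "(\<lambda>n. integral\<^sup>L M (u n)) sums (\<integral>x. (\<Sum>n. u n x) \<partial>M)"
    proof (rule sums_integral[OF ui])
      show "AE x in M. summable (\<lambda>n. norm (u n x))"
        using un by (intro AE_I2 summable_comparison_test'[OF summable_mult[OF exps]]) auto
      show "summable (\<lambda>n. \<integral>x. norm (u n x) \<partial>M)"
      proof (rule summable_comparison_test'[OF summable_mult[OF exps]])
        fix n
        have "(\<integral>x. norm (u n x) \<partial>M) \<le> (\<integral>x. norm (w x) * ((norm \<zeta> * \<bar>B\<bar>) ^ n / fact n) \<partial>M)"
          using ui un w by (intro integral_mono) auto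
        thus "norm (\<integral>x. norm (u n x) \<partial>M) \<le> (\<integral>x. norm (w x) \<partial>M) * ((norm \<zeta> * \<bar>B\<bar>) ^ n / fact n)"
          by simp
      qed
    qed
    moreover have "integral\<^sup>L M (u n) = c n * \<zeta> ^ n" for n
      unfolding c_def u_def
      by (subst integral_mult_left_zero[symmetric]) (simp add: power_mult_distrib mult_ac)
    moreover have "(\<Sum>n. u n x) = w x * exp (\<zeta> * complex_of_real (h x))" for x
      using s1 by (rule sums_unique[symmetric])
    ultimately show ?thesis by simp
  qed
  have ball: "(\<lambda>\<zeta>. \<integral>x. w x * exp (\<zeta> * complex_of_real (h x)) \<partial>M) holomorphic_on ball 0 r" for r
    using sums by (intro power_series_holomorphic[where a = c]) simp
  have "(\<lambda>\<zeta>. \<integral>x. w x * exp (\<zeta> * complex_of_real (h x)) \<partial>M) field_differentiable at \<zeta>" for \<zeta>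
    using ball[of "norm \<zeta> + 1"] by (rule holomorphic_on_imp_differentiable_at) auto
  thus ?thesis by (simp add: holomorphic_on_def field_differentiable_at_within)
qed

text \<open>The maximum principle is applied on a rectangle to F(\<zeta>) C^(-\<zeta>) exp
  (\<epsilon> (\<zeta>^2 - 1)). The power of C normalizes both vertical sides to 1; the Gaussian
  factor has modulus at most 1 on the strip and decays vertically, which settles the horizontal
  sides. Then \<epsilon> tends to 0 at the fixed point \<theta>.\<close>

lemma Hadamard_three_lines:
  fixes F :: "complex \<Rightarrow> complex"
  assumes F: "F holomorphic_on UNIV" and "0 < C"
    and bd: "\<And>\<zeta>. 0 \<le> Re \<zeta> \<Longrightarrow> Re \<zeta> \<le> 1 \<Longrightarrow> norm (F \<zeta>) \<le> K"
    and left: "\<And>\<zeta>. Re \<zeta> = 0 \<Longrightarrow> norm (F \<zeta>) \<le> 1"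
    and right: "\<And>\<zeta>. Re \<zeta> = 1 \<Longrightarrow> norm (F \<zeta>) \<le> C"
    and \<theta>: "0 \<le> \<theta>" "\<theta> \<le> 1"
  shows "norm (F (complex_of_real \<theta>)) \<le> C powr \<theta>"
proof -
  have K: "0 \<le> K" using order_trans[OF norm_ge_zero bd[of 0]] by simp
  \<comment> \<open>\<open>L\<close> bounds the modulus of F(\<zeta>) C^(-\<zeta>) on the strip:
    C^(-x) is at most 1 or at most 1 / C, according to the sign of ln C.\<close>
  define L where "L = K * (1 + 1 / C)"
  have L: "0 \<le> L" using K \<open>0 < C\<close> by (simp add: L_def)
  have eps: "norm (F (complex_of_real \<theta>)) * exp (- \<theta> * ln C) * exp (\<epsilon> * (\<theta>\<^sup>2 - 1)) \<le> 1" if \<epsilon>: "0 < \<epsilon>" for \<epsilon> :: real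
  proof -
    define G where "G \<zeta> = F \<zeta> * exp (- \<zeta> * complex_of_real (ln C)) * exp (complex_of_real \<epsilon> * (\<zeta>\<^sup>2 - 1))" for \<zeta>
    have Gn: "norm (G \<zeta>) = norm (F \<zeta>) * exp (- Re \<zeta> * ln C) * exp (\<epsilon> * ((Re \<zeta>)\<^sup>2 - (Im \<zeta>)\<^sup>2 - 1))" for \<zeta>
      by (simp add: G_def norm_mult power2_eq_square)
    have Gh: "G holomorphic_on UNIV"
      unfolding G_def using F by (intro holomorphic_intros)
    \<comment> \<open>With \<epsilon> Y^2 = L the Gaussian factor is at most exp (- L) on the
      horizontal sides, and L exp (- L) \<le> 1.\<close>
    define Y where "Y = sqrt (L / \<epsilon>)"
    have Y: "0 \<le> Y" "\<epsilon> * Y\<^sup>2 = L" using L \<epsilon> by (simp_all add: Y_def)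
    define R where "R = cbox (Complex 0 (- Y)) (Complex 1 Y)"
    have R: "\<zeta> \<in> R \<longleftrightarrow> 0 \<le> Re \<zeta> \<and> Re \<zeta> \<le> 1 \<and> - Y \<le> Im \<zeta> \<and> Im \<zeta> \<le> Y" for \<zeta>
      by (auto simp: R_def in_cbox_complex_iff)
    have g1: "exp (\<epsilon> * (x\<^sup>2 - y\<^sup>2 - 1)) \<le> exp (- \<epsilon> * y\<^sup>2)" if "0 \<le> x" "x \<le> 1" for x y :: real
    proof -
      have "x\<^sup>2 \<le> 1" using that by (simp add: power_le_one)
      hence "\<epsilon> * (x\<^sup>2 - y\<^sup>2 - 1) \<le> \<epsilon> * (- y\<^sup>2)" using \<epsilon> by (intro mult_left_mono) auto
      thus ?thesis by simp
    qed
    have g0: "exp (\<epsilon> * (x\<^sup>2 - y\<^sup>2 - 1)) \<le> 1" if "0 \<le> x" "x \<le> 1" for x y :: real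
    proof -
      have "exp (- \<epsilon> * y\<^sup>2) \<le> 1" using \<epsilon> by simp
      with g1[OF that, of y] show ?thesis by linarith
    qed
    have "norm (G (complex_of_real \<theta>)) \<le> 1"
    proof (rule maximum_modulus_frontier[where S = R and f = G and \<xi> = "complex_of_real \<theta>"])
      show "G holomorphic_on interior R" "continuous_on (closure R) G"
        using Gh by (auto intro: holomorphic_on_subset holomorphic_on_imp_continuous_on)
      show "bounded R" by (simp add: R_def)
      show "complex_of_real \<theta> \<in> R" using \<theta> Y by (simp add: R)
      fix \<zeta> assume "\<zeta> \<in> frontier R"
      hence \<zeta>: "\<zeta> \<in> R" "\<not> (0 < Re \<zeta> \<and> Re \<zeta> < 1 \<and> - Y < Im \<zeta> \<and> Im \<zeta> < Y)"
        by (auto simp: R_def frontier_cbox in_box_complex_iff)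
      have x: "0 \<le> Re \<zeta>" "Re \<zeta> \<le> 1" using \<zeta>(1) by (auto simp: R)
      consider "Re \<zeta> = 0" | "Re \<zeta> = 1" | "Im \<zeta> = Y \<or> Im \<zeta> = - Y" using \<zeta> R by fastforce
      thus "norm (G \<zeta>) \<le> 1"
      proof cases
        case 1
        from mult_mono[OF left[OF this] g0[OF x, of "Im \<zeta>"]] 1 show ?thesis by (simp add: Gn)
      next
        case 2
        have "norm (F \<zeta>) * exp (- ln C) \<le> 1"
          using right[OF 2] \<open>0 < C\<close> by (simp add: exp_minus field_simps)
        from mult_mono[OF this g0[OF x, of "Im \<zeta>"]] 2 show ?thesis by (simp add: Gn)
      next
        case 3
        have "exp (- Re \<zeta> * ln C) \<le> 1 + 1 / C"
        proof (cases "0 \<le> ln C")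
          case True
          hence "exp (- Re \<zeta> * ln C) \<le> 1" using x by simp
          thus ?thesis using \<open>0 < C\<close> by (smt (verit) divide_pos_pos)
        next
          case False
          hence "Re \<zeta> * (- ln C) \<le> 1 * (- ln C)" using x by (intro mult_right_mono) auto
          hence "exp (- Re \<zeta> * ln C) \<le> exp (- ln C)" by simp
          also have "\<dots> = 1 / C" using \<open>0 < C\<close> by (simp add: exp_minus divide_inverse)
          finally show ?thesis by simp
        qed
        with bd[OF x] have "norm (F \<zeta>) * exp (- Re \<zeta> * ln C) \<le> L"
          unfolding L_def using K by (intro mult_mono) auto
        moreover have "exp (\<epsilon> * ((Re \<zeta>)\<^sup>2 - (Im \<zeta>)\<^sup>2 - 1)) \<le> exp (- L)"
          using g1[OF x, of "Im \<zeta>"] 3 Y by auto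
        ultimately have "norm (G \<zeta>) \<le> L * exp (- L)"
          unfolding Gn using L by (intro mult_mono) auto
        also have "\<dots> \<le> 1"
        proof -
          have "L \<le> exp L" using exp_ge_add_one_self[of L] by linarith
          thus ?thesis by (simp add: exp_minus field_simps)
        qed
        finally show ?thesis .
      qed
    qed
    thus ?thesis by (simp add: Gn)
  qed
  have "((\<lambda>\<epsilon>. norm (F (complex_of_real \<theta>)) * exp (- \<theta> * ln C) * exp (\<epsilon> * (\<theta>\<^sup>2 - 1))) \<longlongrightarrow>
    norm (F (complex_of_real \<theta>)) * exp (- \<theta> * ln C) * exp (0 * (\<theta>\<^sup>2 - 1))) (at_right 0)"
    by (intro tendsto_intros)
  hence "norm (F (complex_of_real \<theta>)) * exp (- \<theta> * ln C) * exp (0 * (\<theta>\<^sup>2 - 1)) \<le> 1"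
    using eps by (rule tendsto_upperbound[OF _ eventually_at_right_less[THEN eventually_mono]]) auto
  thus ?thesis using \<open>0 < C\<close> by (simp add: powr_def exp_minus field_simps)
qed

text \<open>
  Lower bounds on \<open>\<bar>f\<bar>\<close> and \<open>\<bar>g\<bar>\<close> keep the logarithms bounded, so that the analytic family
  \<open>sgn f * \<bar>f\<bar> powr (p * (1 - \<zeta> / 2))\<close> depends on \<open>\<zeta>\<close> through a bounded exponent.
\<close>
lemma Riesz_Thorin_bilinear:
  fixes k :: "'a \<times> 'b \<Rightarrow> complex" and f :: "'a \<Rightarrow> complex" and g :: "'b \<Rightarrow> complex"
  assumes M: "finite_measure M" and N: "finite_measure N"
    and [measurable]: "k \<in> borel_measurable (M \<Otimes>\<^sub>M N)" "f \<in> borel_measurable M" "g \<in> borel_measurable N"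
    and k: "\<And>x y. x \<in> space M \<Longrightarrow> y \<in> space N \<Longrightarrow> norm (k (x, y)) \<le> 1"
    and "0 < a" and f: "\<And>x. x \<in> space M \<Longrightarrow> a \<le> norm (f x) \<and> norm (f x) \<le> b"
    and g: "\<And>y. y \<in> space N \<Longrightarrow> a \<le> norm (g y) \<and> norm (g y) \<le> b"
    and p: "1 \<le> p" "p \<le> 2"
    and fp: "(\<integral>x. norm (f x) powr p \<partial>M) \<le> 1" and gp: "(\<integral>y. norm (g y) powr p \<partial>N) \<le> 1"
    and "0 < C"
    and L2: "\<And>\<phi> \<psi> B. \<phi> \<in> borel_measurable M \<Longrightarrow> \<psi> \<in> borel_measurable N \<Longrightarrow>
      (\<And>x. x \<in> space M \<Longrightarrow> norm (\<phi> x) \<le> B) \<Longrightarrow> (\<And>y. y \<in> space N \<Longrightarrow> norm (\<psi> y) \<le> B) \<Longrightarrow>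
      (\<integral>x. (norm (\<phi> x))\<^sup>2 \<partial>M) \<le> 1 \<Longrightarrow> (\<integral>y. (norm (\<psi> y))\<^sup>2 \<partial>N) \<le> 1 \<Longrightarrow>
      norm (\<integral>(x, y). k (x, y) * \<phi> x * \<psi> y \<partial>(M \<Otimes>\<^sub>M N)) \<le> C"
  shows "norm (\<integral>(x, y). k (x, y) * f x * g y \<partial>(M \<Otimes>\<^sub>M N)) \<le> C powr (2 - 2 / p)"
proof -
  interpret M: finite_measure M by fact
  interpret N: finite_measure N by fact
  interpret P: pair_sigma_finite M N ..
  interpret MN: finite_measure "M \<Otimes>\<^sub>M N" by (rule finite_measure_pair_measure) fact+
  \<comment> \<open>The modulus of \<open>tw u \<zeta>\<close> is |u|^p on Re \<zeta> = 0, so p-th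
    powers become L1 norms, and |u|^(p/2) on Re \<zeta> = 1, so they become squared L2 norms. At
    \<zeta> = 2 - 2/p the exponent is 1 and \<open>tw u \<zeta>\<close> is \<open>u\<close>. Both
    functions are twisted in the same way, since the dual of the target exponent is p again.\<close>
  define tw where "tw u \<zeta> = sgn u * exp (complex_of_real (p * ln (norm u)) * (1 - \<zeta> / 2))" for u \<zeta> :: complex
  have [measurable]: "(\<lambda>x. tw (u x) \<zeta>) \<in> borel_measurable A" if "u \<in> borel_measurable A" for u \<zeta> and A :: "'a measure"
    using that unfolding tw_def sgn_div_norm by measurable
  have [measurable]: "(\<lambda>x. tw (u x) \<zeta>) \<in> borel_measurable A" if "u \<in> borel_measurable A" for u \<zeta> and A :: "'b measure"
    using that unfolding tw_def sgn_div_norm by measurable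
  have twn: "norm (tw u \<zeta>) = norm u powr (p * (1 - Re \<zeta> / 2))" if "u \<noteq> 0" for u \<zeta>
    using that by (simp add: tw_def norm_mult norm_sgn powr_def mult_ac)
  have f0: "f x \<noteq> 0" if "x \<in> space M" for x using f[OF that] \<open>0 < a\<close> by auto
  have g0: "g y \<noteq> 0" if "y \<in> space N" for y using g[OF that] \<open>0 < a\<close> by auto
  define l where "l = max \<bar>ln a\<bar> \<bar>ln b\<bar>"
  have lnb: "\<bar>ln s\<bar> \<le> l" if "a \<le> s" "s \<le> b" for s
  proof -
    have "ln a \<le> ln s" "ln s \<le> ln b" using that \<open>0 < a\<close> by auto
    thus ?thesis unfolding l_def by linarith
  qed
  define \<Phi> where "\<Phi> \<zeta> = (\<integral>(x, y). k (x, y) * tw (f x) \<zeta> * tw (g y) \<zeta> \<partial>(M \<Otimes>\<^sub>M N))" for \<zeta>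
  \<comment> \<open>The whole dependence on \<zeta> is the factor exp (\<zeta> h), with
    \<open>w\<close> the integrand at \<zeta> = 0. This is the form required by
    \<open>holomorphic_integral_exp\<close>.\<close>
  define h where "h = (\<lambda>(x, y). - p / 2 * (ln (norm (f x)) + ln (norm (g y))))"
  define w where "w = (\<lambda>(x, y). k (x, y) * tw (f x) 0 * tw (g y) 0)"
  have hb: "\<bar>h z\<bar> \<le> p * l" if "z \<in> space (M \<Otimes>\<^sub>M N)" for z
  proof -
    obtain x y where z: "z = (x, y)" "x \<in> space M" "y \<in> space N" using \<open>z \<in> _\<close> by (auto simp: space_pair_measure)
    have "\<bar>ln (norm (f x)) + ln (norm (g y))\<bar> \<le> 2 * l"
      using lnb[of "norm (f x)"] lnb[of "norm (g y)"] f[OF z(2)] g[OF z(3)] by (auto intro: order_trans[OF abs_triangle_ineq])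
    from mult_left_mono[OF this, of "p / 2"] p show ?thesis by (simp add: h_def z abs_mult)
  qed
  have twb: "norm (tw u \<zeta>) \<le> exp (p * l)" if "a \<le> norm u" "norm u \<le> b" "0 \<le> Re \<zeta>" "Re \<zeta> \<le> 1" for u \<zeta>
  proof -
    have "ln (norm u) * (1 - Re \<zeta> / 2) \<le> \<bar>ln (norm u)\<bar> * 1"
      using that by (intro mult_mono) auto
    also have "\<dots> \<le> l" using lnb[OF that(1,2)] by simp
    finally have "p * (ln (norm u) * (1 - Re \<zeta> / 2)) \<le> p * l" using p by (intro mult_left_mono) auto
    hence "p * ln (norm u) * (1 - Re \<zeta> / 2) \<le> p * l" by (simp only: mult.assoc)
    thus ?thesis by (simp add: tw_def norm_mult norm_sgn)
  qed
  have kb: "norm (k (x, y) * tw (f x) \<zeta> * tw (g y) \<zeta>) \<le> exp (p * l) * exp (p * l)"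
    if "x \<in> space M" "y \<in> space N" "0 \<le> Re \<zeta>" "Re \<zeta> \<le> 1" for x y \<zeta>
    using mult_mono[OF mult_mono[OF k[OF that(1,2)] twb[of "f x" \<zeta>]] twb[of "g y" \<zeta>]] f[OF that(1)] g[OF that(2)] that(3,4)
    by (simp add: norm_mult)
  have w: "integrable (M \<Otimes>\<^sub>M N) w"
  proof (rule MN.integrable_const_bound)
    show "AE z in M \<Otimes>\<^sub>M N. norm (w z) \<le> exp (p * l) * exp (p * l)"
      using kb[of _ _ 0] by (intro AE_I2) (auto simp: w_def space_pair_measure)
  qed (simp add: w_def)
  have tw0: "tw u \<zeta> = tw u 0 * exp (\<zeta> * complex_of_real (- p / 2 * ln (norm u)))" for u \<zeta>
  proof -
    have "complex_of_real (p * ln (norm u)) * (1 - \<zeta> / 2) =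
        complex_of_real (p * ln (norm u)) * (1 - 0 / 2) + \<zeta> * complex_of_real (- p / 2 * ln (norm u))"
      by (simp add: field_simps)
    thus ?thesis unfolding tw_def by (simp only: exp_add mult.assoc)
  qed
  have \<Phi>w: "\<Phi> \<zeta> = (\<integral>z. w z * exp (\<zeta> * complex_of_real (h z)) \<partial>(M \<Otimes>\<^sub>M N))" for \<zeta>
    unfolding \<Phi>_def
  proof (intro Bochner_Integration.integral_cong refl)
    fix z :: "'a \<times> 'b"
    obtain x y where z: "z = (x, y)" by (cases z)
    have "h z = - p / 2 * ln (norm (f x)) + - p / 2 * ln (norm (g y))" by (simp only: z h_def prod.case distrib_left)
    hence "exp (\<zeta> * complex_of_real (h z)) = exp (\<zeta> * complex_of_real (- p / 2 * ln (norm (f x)))) *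
        exp (\<zeta> * complex_of_real (- p / 2 * ln (norm (g y))))"
      by (simp only: of_real_add distrib_left exp_add)
    thus "(case z of (x, y) \<Rightarrow> k (x, y) * tw (f x) \<zeta> * tw (g y) \<zeta>) = w z * exp (\<zeta> * complex_of_real (h z))"
      by (simp only: z prod.case w_def tw0[of "f x" \<zeta>] tw0[of "g y" \<zeta>] mult_ac)
  qed
  have hol: "\<Phi> holomorphic_on UNIV"
    unfolding \<Phi>w using hb by (intro holomorphic_integral_exp[OF w]) (auto simp: h_def)
  have \<Phi>K: "norm (\<Phi> \<zeta>) \<le> exp (p * l) * exp (p * l) * measure (M \<Otimes>\<^sub>M N) (space (M \<Otimes>\<^sub>M N))" if "0 \<le> Re \<zeta>" "Re \<zeta> \<le> 1" for \<zeta>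
  proof -
    have "norm (\<Phi> \<zeta>) \<le> (\<integral>z. exp (p * l) * exp (p * l) \<partial>(M \<Otimes>\<^sub>M N))"
      unfolding \<Phi>_def using kb that by (intro norm_integral_le) (auto simp: space_pair_measure)
    thus ?thesis by (simp add: mult_ac)
  qed
  have fi: "integrable M (\<lambda>x. norm (f x) powr p)"
  proof (rule M.integrable_const_bound)
    show "AE x in M. norm (norm (f x) powr p) \<le> b powr p" using f p by (intro AE_I2) (auto intro!: powr_mono2)
  qed measurable
  have gi: "integrable N (\<lambda>x. norm (g x) powr p)"
  proof (rule N.integrable_const_bound)
    show "AE x in N. norm (norm (g x) powr p) \<le> b powr p" using g p by (intro AE_I2) (auto intro!: powr_mono2)
  qed measurable
  have left: "norm (\<Phi> \<zeta>) \<le> 1" if "Re \<zeta> = 0" for \<zeta>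
  proof -
    have i: "integrable (M \<Otimes>\<^sub>M N) (\<lambda>(x, y). norm (f x) powr p * norm (g y) powr p)"
    proof (rule MN.integrable_const_bound)
      show "AE z in M \<Otimes>\<^sub>M N. norm (case z of (x, y) \<Rightarrow> norm (f x) powr p * norm (g y) powr p) \<le> b powr p * b powr p"
        using f g p by (intro AE_I2) (auto simp: space_pair_measure intro!: mult_mono powr_mono2)
    qed measurable
    have "norm (\<Phi> \<zeta>) \<le> (\<integral>(x, y). norm (f x) powr p * norm (g y) powr p \<partial>(M \<Otimes>\<^sub>M N))"
      unfolding \<Phi>_def
    proof (rule norm_integral_le[OF i])
      fix z assume "z \<in> space (M \<Otimes>\<^sub>M N)"
      then obtain x y where z: "z = (x, y)" "x \<in> space M" "y \<in> space N" by (auto simp: space_pair_measure)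
      show "norm (case z of (x, y) \<Rightarrow> k (x, y) * tw (f x) \<zeta> * tw (g y) \<zeta>) \<le> (case z of (x, y) \<Rightarrow> norm (f x) powr p * norm (g y) powr p)"
        using mult_right_mono[OF k[OF z(2,3)], of "norm (f x) powr p * norm (g y) powr p"] that f0[OF z(2)] g0[OF z(3)]
        by (simp add: z(1) norm_mult twn mult.assoc)
    qed
    also have "\<dots> = (\<integral>x. \<integral>y. norm (f x) powr p * norm (g y) powr p \<partial>N \<partial>M)"
      using P.integral_fst[OF i] by simp
    also have "\<dots> = (\<integral>x. norm (f x) powr p \<partial>M) * (\<integral>y. norm (g y) powr p \<partial>N)" by simp
    also have "\<dots> \<le> 1" using fp gp by (intro mult_le_one) auto
    finally show ?thesis .
  qed
  have right: "norm (\<Phi> \<zeta>) \<le> C" if "Re \<zeta> = 1" for \<zeta>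
    unfolding \<Phi>_def
  proof (rule L2[where B = "exp (p * l)"])
    have sq: "(norm (tw u \<zeta>))\<^sup>2 = norm u powr p" if "u \<noteq> 0" for u
      using that \<open>Re \<zeta> = 1\<close> by (simp add: twn powr_powr flip: powr_realpow)
    have "(\<integral>x. (norm (tw (f x) \<zeta>))\<^sup>2 \<partial>M) = (\<integral>x. norm (f x) powr p \<partial>M)"
      using f0 by (intro Bochner_Integration.integral_cong) (auto simp: sq)
    thus "(\<integral>x. (norm (tw (f x) \<zeta>))\<^sup>2 \<partial>M) \<le> 1" using fp by simp
    have "(\<integral>x. (norm (tw (g x) \<zeta>))\<^sup>2 \<partial>N) = (\<integral>x. norm (g x) powr p \<partial>N)"
      using g0 by (intro Bochner_Integration.integral_cong) (auto simp: sq)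
    thus "(\<integral>x. (norm (tw (g x) \<zeta>))\<^sup>2 \<partial>N) \<le> 1" using gp by simp
  qed (use twb f g that in auto)
  have \<theta>: "0 \<le> 2 - 2 / p" "2 - 2 / p \<le> 1" using p by (auto simp: field_simps)
  have id: "tw u (complex_of_real (2 - 2 / p)) = u" if "u \<noteq> 0" for u
  proof -
    have "complex_of_real (p * ln (norm u)) * (1 - complex_of_real (2 - 2 / p) / 2) = complex_of_real (p * ln (norm u) * (1 - (2 - 2 / p) / 2))"
      by simp
    also have "p * ln (norm u) * (1 - (2 - 2 / p) / 2) = ln (norm u)" using p by (simp add: field_simps)
    finally have e: "complex_of_real (p * ln (norm u)) * (1 - complex_of_real (2 - 2 / p) / 2) = complex_of_real (ln (norm u))" .
    have "tw u (complex_of_real (2 - 2 / p)) = sgn u * complex_of_real (norm u)"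
      unfolding tw_def e exp_of_real using that by simp
    thus ?thesis using that by (simp add: sgn_eq)
  qed
  have "norm (\<Phi> (complex_of_real (2 - 2 / p))) \<le> C powr (2 - 2 / p)"
    by (rule Hadamard_three_lines[OF hol \<open>0 < C\<close> \<Phi>K left right \<theta>])
  also have "\<Phi> (complex_of_real (2 - 2 / p)) = (\<integral>(x, y). k (x, y) * f x * g y \<partial>(M \<Otimes>\<^sub>M N))"
    unfolding \<Phi>_def using id f0 g0
    by (intro Bochner_Integration.integral_cong) (auto simp: space_pair_measure)
  finally show ?thesis .
qed

text \<open>The bilinear form is tested on the extremal function g = cnj (sgn u) |u|^(q-1) I^(-1/p),
  where I is the integral to be bounded. It has unit Lp norm because (q - 1) p = q, and the pairing
  of u with g equals I^(1/q). The lower bounds on |f| and |u| make both arguments admissible for the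
  interpolation lemma.\<close>

lemma laplace_Lq_restricted:
  fixes f z :: "real \<Rightarrow> complex"
  assumes [measurable]: "f \<in> borel_measurable borel" "z \<in> borel_measurable borel"
      "A \<in> sets borel" "E \<in> sets borel"
    and A: "A \<subseteq> {0..n}" and E: "E \<subseteq> {c..d}"
    and z: "\<And>r. r \<in> E \<Longrightarrow> norm (z r) = r \<and> \<delta> \<le> Re (z r)" and "0 < \<delta>"
    and "0 < a" and f: "\<And>t. t \<in> A \<Longrightarrow> a \<le> norm (f t) \<and> norm (f t) \<le> b"
    and p: "1 < p" "p \<le> 2" "1 / p + 1 / q = 1"
    and fp: "(\<integral>\<^sup>+ t. ennreal (norm (f t) powr p) * indicator A t \<partial>lborel) \<le> 1"
  defines "u \<equiv> \<lambda>r. \<integral>t. indicat_real A t *\<^sub>R (exp (- (z r * complex_of_real t)) * f t) \<partial>lborel"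
  assumes u: "\<And>r. r \<in> E \<Longrightarrow> a \<le> norm (u r)"
  shows "(\<integral>\<^sup>+ r. ennreal (norm (u r) powr q) * indicator E r \<partial>lborel) \<le> ennreal (384 * pi)"
proof -
  define M where "M = restrict_space lborel A"
  define N where "N = restrict_space lborel E"
  have sp: "space M = A" "space N = E" by (simp_all add: M_def N_def space_restrict_space)
  have "emeasure lborel A \<le> emeasure lborel {0..n}" using A by (intro emeasure_mono) auto
  hence "emeasure lborel A < \<infinity>" using emeasure_lborel_Icc_eq[of 0 n] by (auto simp: less_top[symmetric] top_unique split: if_splits)
  hence Mf: "finite_measure M" by (intro finite_measureI) (simp add: sp M_def emeasure_restrict_space)
  have "emeasure lborel E \<le> emeasure lborel {c..d}" using E by (intro emeasure_mono) auto
  hence "emeasure lborel E < \<infinity>" using emeasure_lborel_Icc_eq[of c d] by (auto simp: less_top[symmetric] top_unique split: if_splits)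
  hence Nf: "finite_measure N" by (intro finite_measureI) (simp add: sp N_def emeasure_restrict_space)
  interpret M: finite_measure M by fact
  interpret N: finite_measure N by fact
  interpret P: pair_sigma_finite M N ..
  interpret MN: finite_measure "M \<Otimes>\<^sub>M N" by (rule finite_measure_pair_measure) fact+
  have mM: "h \<in> borel_measurable M" if "h \<in> borel_measurable borel" for h :: "real \<Rightarrow> complex"
    unfolding M_def using that by (intro measurable_restrict_space1) simp
  have mN: "h \<in> borel_measurable N" if "h \<in> borel_measurable borel" for h :: "real \<Rightarrow> complex"
    unfolding N_def using that by (intro measurable_restrict_space1) simp
  have [measurable]: "z \<in> borel_measurable N" "f \<in> borel_measurable M" by (auto intro!: mM mN)
  have [measurable]: "(\<lambda>t. complex_of_real t) \<in> borel_measurable M" by (auto intro!: mM)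
  have um [measurable]: "u \<in> borel_measurable borel" unfolding u_def by measurable
  have [measurable]: "u \<in> borel_measurable N" by (rule mN) measurable
  define k where "k = (\<lambda>(t, r). exp (- (z r * complex_of_real t)))"
  have [measurable]: "k \<in> borel_measurable (M \<Otimes>\<^sub>M N)" unfolding k_def by measurable
  have k: "norm (k (t, r)) \<le> 1" if "t \<in> space M" "r \<in> space N" for t r
  proof -
    have "0 \<le> t" "0 \<le> Re (z r)" using that A z[of r] \<open>0 < \<delta>\<close> by (auto simp: sp)
    thus ?thesis by (simp add: k_def)
  qed
  have Mint: "(\<integral>t. k (t, r) * \<phi> t \<partial>M) = (\<integral>t. indicat_real A t *\<^sub>R (exp (- (z r * complex_of_real t)) * \<phi> t) \<partial>lborel)" for r \<phi>
    unfolding M_def k_def by (subst integral_restrict_space) auto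
  have kint: "integrable (M \<Otimes>\<^sub>M N) (\<lambda>(t, r). k (t, r) * \<phi> t * \<psi> r)"
    if [measurable]: "\<phi> \<in> borel_measurable M" "\<psi> \<in> borel_measurable N"
      and b: "\<And>t. t \<in> space M \<Longrightarrow> norm (\<phi> t) \<le> B" "\<And>r. r \<in> space N \<Longrightarrow> norm (\<psi> r) \<le> B" for \<phi> \<psi> and B :: real
  proof (rule MN.integrable_const_bound)
    have "norm (k (t, r) * \<phi> t * \<psi> r) \<le> 1 * B * B" if "t \<in> space M" "r \<in> space N" for t r
    proof -
      have "0 \<le> B" using b(1)[OF that(1)] norm_ge_zero order_trans by blast
      thus ?thesis unfolding norm_mult using k[OF that] b(1)[OF that(1)] b(2)[OF that(2)] by (intro mult_mono) auto
    qed
    thus "AE x in M \<Otimes>\<^sub>M N. norm (case x of (t, r) \<Rightarrow> k (t, r) * \<phi> t * \<psi> r) \<le> 1 * B * B"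
      by (intro AE_I2) (auto simp: space_pair_measure)
  qed measurable
  have swap: "(\<integral>(t, r). k (t, r) * \<phi> t * \<psi> r \<partial>(M \<Otimes>\<^sub>M N)) = (\<integral>r. (\<integral>t. k (t, r) * \<phi> t \<partial>M) * \<psi> r \<partial>N)"
    if "\<phi> \<in> borel_measurable M" "\<psi> \<in> borel_measurable N"
      "\<And>t. t \<in> space M \<Longrightarrow> norm (\<phi> t) \<le> B" "\<And>r. r \<in> space N \<Longrightarrow> norm (\<psi> r) \<le> B" for \<phi> \<psi> and B :: real
    using P.integral_snd[OF kint[OF that]] by simp
  \<comment> \<open>384 pi bounds the square of the operator norm, hence the square root.\<close>
  have L2: "norm (\<integral>(t, r). k (t, r) * \<phi> t * \<psi> r \<partial>(M \<Otimes>\<^sub>M N)) \<le> sqrt (384 * pi)"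
    if \<phi>m: "\<phi> \<in> borel_measurable M" and [measurable]: "\<psi> \<in> borel_measurable N"
      and b: "\<And>t. t \<in> space M \<Longrightarrow> norm (\<phi> t) \<le> B" "\<And>r. r \<in> space N \<Longrightarrow> norm (\<psi> r) \<le> B"
      and \<phi>1: "(\<integral>t. (norm (\<phi> t))\<^sup>2 \<partial>M) \<le> 1" and \<psi>1: "(\<integral>r. (norm (\<psi> r))\<^sup>2 \<partial>N) \<le> 1" for \<phi> \<psi> and B :: real
  proof -
    note [measurable] = \<phi>m
    define \<phi>' where "\<phi>' t = indicat_real A t *\<^sub>R \<phi> t" for t
    have [measurable]: "\<phi>' \<in> borel_measurable borel"
      using \<phi>m unfolding M_def \<phi>'_def by (simp add: borel_measurable_restrict_space_iff)
    define v where "v r = (\<integral>t. \<phi>' t * exp (- (z r * complex_of_real t)) \<partial>lborel)" for r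
    have [measurable]: "v \<in> borel_measurable borel" unfolding v_def by measurable
    have [measurable]: "v \<in> borel_measurable N" by (rule mN) measurable
    have vM: "(\<integral>t. k (t, r) * \<phi> t \<partial>M) = v r" for r
      unfolding Mint v_def \<phi>'_def by (simp add: mult.commute)
    have \<phi>'2: "(\<integral>\<^sup>+ t. ennreal ((norm (\<phi>' t))\<^sup>2) \<partial>lborel) \<le> 1"
    proof -
      have "integrable M (\<lambda>t. (norm (\<phi> t))\<^sup>2)"
        using b(1) by (intro M.integrable_const_bound[where B = "B\<^sup>2"]) (auto intro!: AE_I2 power_mono)
      hence "(\<integral>\<^sup>+ t. ennreal ((norm (\<phi> t))\<^sup>2) \<partial>M) = ennreal (\<integral>t. (norm (\<phi> t))\<^sup>2 \<partial>M)"
        by (intro nn_integral_eq_integral) auto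
      also have "\<dots> \<le> 1" using \<phi>1 by (simp add: ennreal_le_1)
      also have "(\<integral>\<^sup>+ t. ennreal ((norm (\<phi> t))\<^sup>2) \<partial>M) = (\<integral>\<^sup>+ t. ennreal ((norm (\<phi>' t))\<^sup>2) \<partial>lborel)"
        unfolding M_def by (subst nn_integral_restrict_space)
          (auto simp: \<phi>'_def indicator_def intro!: nn_integral_cong)
      finally show ?thesis .
    qed
    have \<psi>2: "(\<integral>\<^sup>+ r. ennreal ((norm (\<psi> r))\<^sup>2) \<partial>N) \<le> 1"
    proof -
      have "integrable N (\<lambda>t. (norm (\<psi> t))\<^sup>2)"
        using b(2) by (intro N.integrable_const_bound[where B = "B\<^sup>2"]) (auto intro!: AE_I2 power_mono)
      hence "(\<integral>\<^sup>+ t. ennreal ((norm (\<psi> t))\<^sup>2) \<partial>N) = ennreal (\<integral>t. (norm (\<psi> t))\<^sup>2 \<partial>N)"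
        by (intro nn_integral_eq_integral) auto
      also have "\<dots> \<le> 1" using \<psi>1 by (simp add: ennreal_le_1)
      finally show ?thesis .
    qed
    have v2: "(\<integral>\<^sup>+ r. ennreal ((norm (v r))\<^sup>2) \<partial>N) \<le> ennreal (384 * pi)"
    proof -
      have "(\<integral>\<^sup>+ r. ennreal ((norm (v r))\<^sup>2) \<partial>N) = (\<integral>\<^sup>+ r. ennreal ((norm (v r))\<^sup>2) * indicator E r \<partial>lborel)"
        unfolding N_def by (rule nn_integral_restrict_space) simp
      also have "\<dots> \<le> ennreal (384 * pi) * (\<integral>\<^sup>+ t. ennreal ((norm (\<phi>' t))\<^sup>2) \<partial>lborel)"
        unfolding v_def
      proof (rule laplace_L2_bound[OF _ _ _ _ _ E z \<open>0 < \<delta>\<close>])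
        show "norm (\<phi>' t) \<le> max B 0" for t using b(1)[of t] by (auto simp: \<phi>'_def indicator_def sp)
        show "\<phi>' t = 0" if "t \<notin> {0..n}" for t using that A by (auto simp: \<phi>'_def indicator_def)
      qed simp_all
      also have "\<dots> \<le> ennreal (384 * pi) * 1" using \<phi>'2 by (intro mult_left_mono) auto
      finally show ?thesis by simp
    qed
    have "integrable N (\<lambda>r. v r * \<psi> r)"
      using P.integrable_snd[OF kint[OF that(1-4)]] by (simp add: vM)
    hence "norm (\<integral>r. v r * \<psi> r \<partial>N) \<le> (\<integral>\<^sup>+ r. ennreal (norm (v r * \<psi> r)) \<partial>N)"
      by (rule integral_norm_bound_ennreal)
    hence "(ennreal (norm (\<integral>r. v r * \<psi> r \<partial>N)))\<^sup>2 \<le> (\<integral>\<^sup>+ r. ennreal (norm (v r)) * ennreal (norm (\<psi> r)) \<partial>N)\<^sup>2"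
      by (intro power_mono) (simp_all add: norm_mult ennreal_mult)
    also have "\<dots> \<le> (\<integral>\<^sup>+ r. ennreal (norm (v r)) ^ 2 \<partial>N) * (\<integral>\<^sup>+ r. ennreal (norm (\<psi> r)) ^ 2 \<partial>N)"
      by (rule Cauchy_Schwarz_nn_integral) measurable
    also have "\<dots> \<le> ennreal (384 * pi) * 1"
      using v2 \<psi>2 by (intro mult_mono) (simp_all add: ennreal_power)
    finally have "(norm (\<integral>r. v r * \<psi> r \<partial>N))\<^sup>2 \<le> 384 * pi"
      by (simp add: ennreal_power ennreal_le_iff)
    hence "norm (\<integral>r. v r * \<psi> r \<partial>N) \<le> sqrt (384 * pi)" by (rule real_le_rsqrt)
    moreover have "(\<integral>(t, r). k (t, r) * \<phi> t * \<psi> r \<partial>(M \<Otimes>\<^sub>M N)) = (\<integral>r. v r * \<psi> r \<partial>N)"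
      using swap[OF that(1,2) b] by (simp only: vM)
    ultimately show ?thesis by (simp only:)
  qed
  have q: "1 < q" "(q - 1) * p = q"
  proof -
    have "1 / q = 1 - 1 / p" using p by simp
    moreover have "1 / (1 - 1 / p) = p / (p - 1)" using p by (simp add: field_simps)
    ultimately have "q = p / (p - 1)" by (metis div_by_1 divide_divide_eq_right mult_1)
    moreover have "1 < p / (p - 1)" "(p / (p - 1) - 1) * p = p / (p - 1)" using p by (auto simp: field_simps)
    ultimately show "1 < q" "(q - 1) * p = q" by (simp_all only:)
  qed
  define K where "K = (\<integral>t. norm (f t) \<partial>M)"
  have fi: "integrable M f" using f by (intro M.integrable_const_bound[where B = b]) (auto simp: sp)
  have uM: "u r = (\<integral>t. k (t, r) * f t \<partial>M)" for r by (simp add: Mint u_def)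
  have uK: "norm (u r) \<le> K" if "r \<in> E" for r
    unfolding uM K_def
  proof (rule norm_integral_le)
    show "norm (k (t, r) * f t) \<le> norm (f t)" if "t \<in> space M" for t
      using mult_right_mono[OF k[OF that], of r "norm (f t)"] \<open>r \<in> E\<close> by (simp add: norm_mult sp)
  qed (use fi in auto)
  have uqi: "integrable N (\<lambda>r. norm (u r) powr q)"
    using uK q by (intro N.integrable_const_bound[where B = "K powr q"]) (auto simp: sp intro!: AE_I2 powr_mono2)
  define I where "I = (\<integral>r. norm (u r) powr q \<partial>N)"
  have I0: "0 \<le> I" by (simp add: I_def)
  have IE: "(\<integral>\<^sup>+ r. ennreal (norm (u r) powr q) * indicator E r \<partial>lborel) = ennreal I"
  proof -
    have "ennreal I = (\<integral>\<^sup>+ r. ennreal (norm (u r) powr q) \<partial>N)"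
      unfolding I_def by (rule nn_integral_eq_integral[OF uqi, symmetric]) simp
    also have "\<dots> = (\<integral>\<^sup>+ r. ennreal (norm (u r) powr q) * indicator E r \<partial>lborel)"
      unfolding N_def by (rule nn_integral_restrict_space) simp
    finally show ?thesis by simp
  qed
  have "I \<le> 384 * pi"
  proof (cases "I = 0")
    case False
    hence I: "0 < I" using I0 by simp
    define J where "J = I powr (- 1 / p)"
    have J: "0 < J" using I by (simp add: J_def)
    define g where "g r = cnj (sgn (u r)) * complex_of_real (norm (u r) powr (q - 1) * J)" for r
    have [measurable]: "g \<in> borel_measurable N" unfolding g_def sgn_eq by measurable
    have gn: "norm (g r) = norm (u r) powr (q - 1) * J" if "r \<in> E" for r
      using u[OF that] \<open>0 < a\<close> J by (auto simp: g_def norm_mult norm_sgn)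
    \<comment> \<open>The interpolation lemma takes one pair of bounds for both functions. Those for
      \<open>g\<close> come from a \<le> |u| \<le> K, as q > 1 makes the power q - 1
      increasing.\<close>
    define a' where "a' = min a (a powr (q - 1) * J)"
    define b' where "b' = max b (K powr (q - 1) * J)"
    have a': "0 < a'" using \<open>0 < a\<close> J by (simp add: a'_def)
    have f': "a' \<le> norm (f t) \<and> norm (f t) \<le> b'" if "t \<in> space M" for t
      using f[of t] that by (auto simp: a'_def b'_def sp)
    have g': "a' \<le> norm (g r) \<and> norm (g r) \<le> b'" if "r \<in> space N" for r
    proof -
      have r: "r \<in> E" using that by (simp add: sp)
      have "a powr (q - 1) * J \<le> norm (u r) powr (q - 1) * J" "norm (u r) powr (q - 1) * J \<le> K powr (q - 1) * J"
        using u[OF r] uK[OF r] \<open>0 < a\<close> q J by (auto intro!: mult_right_mono powr_mono2)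
      thus ?thesis by (auto simp: gn[OF r] a'_def b'_def)
    qed
    have fM: "(\<integral>t. norm (f t) powr p \<partial>M) \<le> 1"
    proof -
      have "integrable M (\<lambda>t. norm (f t) powr p)"
        using f p by (intro M.integrable_const_bound[where B = "b powr p"]) (auto simp: sp intro!: AE_I2 powr_mono2)
      hence "ennreal (\<integral>t. norm (f t) powr p \<partial>M) = (\<integral>\<^sup>+ t. ennreal (norm (f t) powr p) \<partial>M)"
        by (intro nn_integral_eq_integral[symmetric]) auto
      also have "\<dots> = (\<integral>\<^sup>+ t. ennreal (norm (f t) powr p) * indicator A t \<partial>lborel)"
        unfolding M_def by (rule nn_integral_restrict_space) simp
      finally have "ennreal (\<integral>t. norm (f t) powr p \<partial>M) \<le> 1" using fp by (simp only:)
      thus ?thesis by (simp only: ennreal_le_1)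
    qed
    have gN: "(\<integral>r. norm (g r) powr p \<partial>N) \<le> 1"
    proof -
      have "J powr p = I powr (- 1 / p * p)" unfolding J_def by (rule powr_powr)
      also have "- 1 / p * p = - 1" using p by simp
      finally have Jp: "J powr p = 1 / I" using I by (simp add: powr_minus_divide)
      have "norm (g r) powr p = norm (u r) powr q * (1 / I)" if "r \<in> space N" for r
      proof -
        have "(norm (u r) powr (q - 1) * J) powr p = norm (u r) powr ((q - 1) * p) * J powr p"
          using J by (simp add: powr_mult powr_powr)
        thus ?thesis using gn[of r] that by (simp only: sp q(2) Jp)
      qed
      hence "(\<integral>r. norm (g r) powr p \<partial>N) = (\<integral>r. norm (u r) powr q * (1 / I) \<partial>N)"
        by (intro Bochner_Integration.integral_cong) auto
      also have "\<dots> = 1" using I by (simp add: I_def)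
      finally show ?thesis by simp
    qed
    have "norm (\<integral>(t, r). k (t, r) * f t * g r \<partial>(M \<Otimes>\<^sub>M N)) \<le> sqrt (384 * pi) powr (2 - 2 / p)"
      using p by (intro Riesz_Thorin_bilinear[OF Mf Nf _ _ _ k a' f' g' _ _ fM gN _ L2]) auto
    also have "\<dots> = (384 * pi) powr (1 / q)"
    proof -
      \<comment> \<open>The interpolation exponent is 2/q, which undoes the square root. After
        raising to the power q the bound is 384 pi for every p.\<close>
      have "2 - 2 / p = 2 * (1 / q)" using p(3) by (simp add: field_simps)
      thus ?thesis by (simp only: powr_powr[symmetric]) (simp add: powr_realpow)
    qed
    also have "(\<integral>(t, r). k (t, r) * f t * g r \<partial>(M \<Otimes>\<^sub>M N)) = (\<integral>r. u r * g r \<partial>N)"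
      using f' g' by (subst swap[where B = b']) (auto simp: uM)
    also have "\<dots> = (\<integral>r. complex_of_real (norm (u r) powr q * J) \<partial>N)"
    proof (intro Bochner_Integration.integral_cong refl)
      fix r assume "r \<in> space N"
      hence u0: "0 < norm (u r)" using u[of r] \<open>0 < a\<close> by (auto simp: sp)
      have "u r * cnj (sgn (u r)) = complex_of_real (norm (u r))"
        using u0 by (simp add: sgn_eq complex_norm_square[symmetric] power2_eq_square)
      hence "u r * g r = complex_of_real (norm (u r) * norm (u r) powr (q - 1) * J)"
        unfolding g_def by (simp add: mult.assoc[symmetric])
      also have "norm (u r) * norm (u r) powr (q - 1) = norm (u r) powr q"
        using u0 by (simp add: powr_mult_base)
      finally show "u r * g r = complex_of_real (norm (u r) powr q * J)" .
    qed
    also have "\<dots> = complex_of_real (I * J)"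
      by (subst integral_complex_of_real) (simp add: I_def)
    also have "norm \<dots> = I powr (1 / q)"
    proof -
      have "1 + - 1 / p = 1 / q" using p(3) by simp
      hence "I powr 1 * J = I powr (1 / q)" unfolding J_def powr_add[symmetric] by (simp only:)
      thus ?thesis using I J by simp
    qed
    finally have "I powr (1 / q) \<le> (384 * pi) powr (1 / q)" .
    from powr_mono2[OF _ _ this, of q] show ?thesis using q I by (simp add: powr_powr)
  qed simp
  thus ?thesis unfolding IE by (rule ennreal_leI)
qed

text \<open>Exhaustion by the truncated data of the preceding lemma, whose bound does not depend on
  the truncation. The truncated transforms converge pointwise on \<open>S\<close> by dominated
  convergence. The sets \<open>E i\<close> involve the transforms \<open>u i\<close> and need not
  increase, so the limit is taken by Fatou's lemma and not by monotone convergence.\<close>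

lemma laplace_Lq_bound:
  fixes f z :: "real \<Rightarrow> complex"
  assumes [measurable]: "f \<in> borel_measurable borel" "z \<in> borel_measurable borel" "S \<in> sets borel"
    and z: "\<And>r. r \<in> S \<Longrightarrow> norm (z r) = r \<and> 0 < Re (z r)"
    and p: "1 < p" "p \<le> 2" "1 / p + 1 / q = 1"
    and fp: "(\<integral>\<^sup>+ t. ennreal (norm (f t) powr p) * indicator {0<..} t \<partial>lborel) \<le> 1"
  shows "(\<integral>\<^sup>+ r. ennreal (norm (\<integral>t. indicat_real {0<..} t *\<^sub>R (exp (- (z r * complex_of_real t)) * f t) \<partial>lborel) powr q)
    * indicator S r \<partial>lborel) \<le> ennreal (384 * pi)"
proof -
  define \<epsilon> where "\<epsilon> i = 1 / real (Suc i)" for i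
  define m where "m i = real (Suc i)" for i
  define A where "A i = {t \<in> space borel. 0 < t \<and> t \<le> m i \<and> \<epsilon> i \<le> norm (f t) \<and> norm (f t) \<le> m i}" for i
  define u where "u i r = (\<integral>t. indicat_real (A i) t *\<^sub>R (exp (- (z r * complex_of_real t)) * f t) \<partial>lborel)" for i r
  define U where "U r = (\<integral>t. indicat_real {0<..} t *\<^sub>R (exp (- (z r * complex_of_real t)) * f t) \<partial>lborel)" for r
  have [measurable]: "A i \<in> sets borel" for i unfolding A_def by measurable
  have [measurable]: "u i \<in> borel_measurable borel" for i unfolding u_def by measurable
  have [measurable]: "U \<in> borel_measurable borel" unfolding U_def by measurable
  define E where "E i = S \<inter> {r \<in> space borel. r \<le> m i \<and> \<epsilon> i \<le> Re (z r) \<and> \<epsilon> i \<le> norm (u i r)}" for i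
  have [measurable]: "E i \<in> sets borel" for i unfolding E_def by measurable
  have \<epsilon>0: "0 < \<epsilon> i" for i by (simp add: \<epsilon>_def)
  have \<epsilon>lim: "\<epsilon> \<longlonglongrightarrow> 0" unfolding \<epsilon>_def by (rule LIMSEQ_inverse_real_of_nat[unfolded inverse_eq_divide])
  have ev_\<epsilon>: "\<forall>\<^sub>F i in sequentially. \<epsilon> i \<le> x" if "0 < x" for x
    using order_tendstoD(2)[OF \<epsilon>lim that] by eventually_elim simp
  have ev_m: "\<forall>\<^sub>F i in sequentially. x \<le> m i" for x
  proof -
    obtain k where k: "x \<le> real k" using real_arch_simple by blast
    show ?thesis using eventually_ge_at_top[of k] by eventually_elim (use k in \<open>simp add: m_def\<close>)
  qed
  define w where "w i r = ennreal (norm (u i r) powr q) * indicator (E i) r" for i r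
  have [measurable]: "w i \<in> borel_measurable lborel" for i unfolding w_def by measurable
  have wB: "(\<integral>\<^sup>+ r. w i r \<partial>lborel) \<le> ennreal (384 * pi)" for i
    unfolding w_def u_def
  proof (rule laplace_Lq_restricted[where A = "A i" and n = "m i" and b = "m i" and a = "\<epsilon> i" and \<delta> = "\<epsilon> i" and c = 0 and d = "m i" and p = p])
    show "A i \<subseteq> {0..m i}" by (auto simp: A_def)
    have "0 \<le> r" if "r \<in> S" for r using z[OF that] norm_ge_zero[of "z r"] by simp
    thus "E i \<subseteq> {0..m i}" by (auto simp: E_def)
    show "norm (z r) = r \<and> \<epsilon> i \<le> Re (z r)" if "r \<in> E i" for r using that z by (auto simp: E_def)
    show "\<epsilon> i \<le> norm (f t) \<and> norm (f t) \<le> m i" if "t \<in> A i" for t using that by (auto simp: A_def)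
    show "\<epsilon> i \<le> norm (\<integral>t. indicat_real (A i) t *\<^sub>R (exp (- (z r * complex_of_real t)) * f t) \<partial>lborel)" if "r \<in> E i" for r
      using that by (auto simp: E_def u_def)
    have "(\<integral>\<^sup>+ t. ennreal (norm (f t) powr p) * indicator (A i) t \<partial>lborel) \<le>
        (\<integral>\<^sup>+ t. ennreal (norm (f t) powr p) * indicator {0<..} t \<partial>lborel)"
      by (intro nn_integral_mono mult_left_mono) (auto simp: A_def indicator_def)
    thus "(\<integral>\<^sup>+ t. ennreal (norm (f t) powr p) * indicator (A i) t \<partial>lborel) \<le> 1" using fp by (rule order_trans)
  qed (use \<epsilon>0 p in auto)
  have lim: "(\<lambda>i. u i r) \<longlonglongrightarrow> U r" if "r \<in> S" for r
    unfolding u_def U_def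
  proof (rule integral_dominated_convergence)
    define x where "x = Re (z r)"
    have x: "0 < x" using z[OF that] by (simp add: x_def)
    have i1: "integrable lborel (\<lambda>t. norm (f t) powr p * indicat_real {0<..} t)"
    proof (rule integrableI_nonneg)
      have "(\<integral>\<^sup>+ t. ennreal (norm (f t) powr p * indicat_real {0<..} t) \<partial>lborel) =
        (\<integral>\<^sup>+ t. ennreal (norm (f t) powr p) * indicator {0<..} t \<partial>lborel)"
        by (intro nn_integral_cong) (auto simp: indicator_def)
      thus "(\<integral>\<^sup>+ t. ennreal (norm (f t) powr p * indicat_real {0<..} t) \<partial>lborel) < \<infinity>"
        using fp by (auto intro: le_less_trans)
    qed auto
    have i2: "integrable lborel (\<lambda>t. indicat_real {0..} t * exp (- x * t))"
    proof (rule integrableI_nonneg)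
      have "(\<integral>\<^sup>+ t. ennreal (indicat_real {0..} t * exp (- x * t)) \<partial>lborel) =
        (\<integral>\<^sup>+ t. ennreal (exp (- x * t)) * indicator {0..} t \<partial>lborel)"
        by (intro nn_integral_cong) (auto simp: indicator_def)
      thus "(\<integral>\<^sup>+ t. ennreal (indicat_real {0..} t * exp (- x * t)) \<partial>lborel) < \<infinity>"
        unfolding nn_integral_exp_half_line[OF x] by simp
    qed auto
    \<comment> \<open>The majorant comes from exp (- x t) |f| \<le> |f|^p + exp (- x t): where |f|
      \<le> 1 the second term suffices, elsewhere |f| \<le> |f|^p. It is integrable for each fixed x
      > 0.\<close>
    show "integrable lborel (\<lambda>t. norm (f t) powr p * indicat_real {0<..} t + indicat_real {0..} t * exp (- x * t))"
      using i1 i2 by simp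
    show "AE t in lborel. norm (indicat_real (A i) t *\<^sub>R (exp (- (z r * complex_of_real t)) * f t))
      \<le> norm (f t) powr p * indicat_real {0<..} t + indicat_real {0..} t * exp (- x * t)" for i
    proof (intro AE_I2)
      fix t
      show "norm (indicat_real (A i) t *\<^sub>R (exp (- (z r * complex_of_real t)) * f t))
        \<le> norm (f t) powr p * indicat_real {0<..} t + indicat_real {0..} t * exp (- x * t)"
      proof (cases "t \<in> A i")
        case True
        hence t: "0 < t" by (auto simp: A_def)
        have e1: "exp (- x * t) \<le> 1" using x t by simp
        have "exp (- x * t) * norm (f t) \<le> norm (f t) powr p + exp (- x * t)"
        proof (cases "norm (f t) \<le> 1")
          case True
          have "exp (- x * t) * norm (f t) \<le> exp (- x * t) * 1" using True by (intro mult_left_mono) auto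
          thus ?thesis using powr_ge_zero[of "norm (f t)" p] by linarith
        next
          case False
          have "exp (- x * t) * norm (f t) \<le> 1 * norm (f t)" using e1 by (intro mult_right_mono) auto
          also have "\<dots> = norm (f t) powr 1" using False by simp
          also have "\<dots> \<le> norm (f t) powr p" using False p by (intro powr_mono) auto
          finally show ?thesis by (auto intro: add_increasing2)
        qed
        thus ?thesis using t True by (simp add: norm_mult x_def)
      qed (simp add: indicator_def)
    qed
    show "AE t in lborel. (\<lambda>i. indicat_real (A i) t *\<^sub>R (exp (- (z r * complex_of_real t)) * f t))
       \<longlonglongrightarrow> indicat_real {0<..} t *\<^sub>R (exp (- (z r * complex_of_real t)) * f t)"
    proof (intro AE_I2)
      fix t
      show "(\<lambda>i. indicat_real (A i) t *\<^sub>R (exp (- (z r * complex_of_real t)) * f t))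
       \<longlonglongrightarrow> indicat_real {0<..} t *\<^sub>R (exp (- (z r * complex_of_real t)) * f t)"
      proof (cases "0 < t \<and> f t \<noteq> 0")
        case True
        have "\<forall>\<^sub>F i in sequentially. \<epsilon> i \<le> norm (f t)" using True by (intro ev_\<epsilon>) simp
        hence "\<forall>\<^sub>F i in sequentially. t \<in> A i"
          using ev_m[of t] ev_m[of "norm (f t)"] by eventually_elim (use True in \<open>simp add: A_def\<close>)
        hence "\<forall>\<^sub>F i in sequentially. indicat_real (A i) t *\<^sub>R (exp (- (z r * complex_of_real t)) * f t) =
            indicat_real {0<..} t *\<^sub>R (exp (- (z r * complex_of_real t)) * f t)"
          by eventually_elim (use True in simp)
        thus ?thesis by (rule tendsto_eventually)
      next
        case False
        thus ?thesis by (auto simp: A_def indicator_def)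
      qed
    qed
  qed measurable
  \<comment> \<open>If U r \<noteq> 0, then |u i r| eventually exceeds |U r| / 2 and hence the
    threshold \<epsilon> i, so r eventually belongs to \<open>E i\<close>. Zeros of U contribute 0
    to the left side.\<close>
  have "ennreal (norm (U r) powr q) * indicator S r \<le> liminf (\<lambda>i. w i r)" for r
  proof (cases "r \<in> S \<and> U r \<noteq> 0")
    case True
    hence l: "(\<lambda>i. norm (u i r)) \<longlonglongrightarrow> norm (U r)" by (intro tendsto_norm lim) simp
    have U: "0 < norm (U r)" using True by simp
    have "\<forall>\<^sub>F i in sequentially. norm (U r) / 2 < norm (u i r)"
      using order_tendstoD(1)[OF l, of "norm (U r) / 2"] U by simp
    moreover have "\<forall>\<^sub>F i in sequentially. \<epsilon> i \<le> norm (U r) / 2" using U by (intro ev_\<epsilon>) simp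
    moreover have "\<forall>\<^sub>F i in sequentially. \<epsilon> i \<le> Re (z r)" using True z by (intro ev_\<epsilon>) simp
    ultimately have "\<forall>\<^sub>F i in sequentially. r \<in> E i"
      using ev_m[of r] by eventually_elim (use True in \<open>auto simp: E_def\<close>)
    hence "\<forall>\<^sub>F i in sequentially. ennreal (norm (u i r) powr q) = w i r"
      by eventually_elim (simp add: w_def)
    moreover have "(\<lambda>i. ennreal (norm (u i r) powr q)) \<longlonglongrightarrow> ennreal (norm (U r) powr q)"
      using U by (intro tendsto_ennrealI tendsto_powr l tendsto_const) auto
    ultimately have "(\<lambda>i. w i r) \<longlonglongrightarrow> ennreal (norm (U r) powr q)"
      by (rule Lim_transform_eventually[rotated])
    from lim_imp_Liminf[OF _ this] show ?thesis using True by simp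
  qed auto
  hence "(\<integral>\<^sup>+ r. ennreal (norm (U r) powr q) * indicator S r \<partial>lborel) \<le> (\<integral>\<^sup>+ r. liminf (\<lambda>i. w i r) \<partial>lborel)"
    by (intro nn_integral_mono) auto
  also have "\<dots> \<le> liminf (\<lambda>i. \<integral>\<^sup>+ r. w i r \<partial>lborel)" by (rule nn_integral_liminf) measurable
  also have "\<dots> \<le> limsup (\<lambda>i. \<integral>\<^sup>+ r. w i r \<partial>lborel)" by (rule Liminf_le_Limsup) simp
  also have "\<dots> \<le> ennreal (384 * pi)" by (rule Limsup_bounded) (simp add: wB)
  finally show ?thesis unfolding U_def .
qed

section \<open>Radial curves\<close>

lemma half_line_set_integral:
  fixes g :: "real \<Rightarrow> complex"
  shows "(\<integral>t. g t \<partial>half_line) = (\<integral>t. indicat_real {0<..} t *\<^sub>R g t \<partial>lborel)"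
  unfolding half_line_def by (rule integral_restrict_space) simp

lemma half_line_nn_integral:
  "(\<integral>\<^sup>+ t. g t \<partial>half_line) = (\<integral>\<^sup>+ t. g t * indicator {0<..} t \<partial>lborel)"
  unfolding half_line_def by (rule nn_integral_restrict_space) simp

lemma sigma_finite_half_line: "sigma_finite_measure half_line"
  unfolding half_line_def
  by (rule sigma_finite_measure_restrict_space[OF sigma_finite_lborel]) simp

lemma measurable_laplace:
  assumes [measurable]: "f \<in> borel_measurable half_line"
  shows "laplace f \<in> borel_measurable borel"
proof -
  interpret sigma_finite_measure half_line by (rule sigma_finite_half_line)
  have [measurable]: "(\<lambda>t. complex_of_real t) \<in> borel_measurable half_line"
    unfolding half_line_def by (intro measurable_restrict_space1) simp
  show ?thesis unfolding laplace_def by measurable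
qed

text \<open>Measurability is read off from the value \<infinity> that \<open>Lp_norm\<close> assigns
  to non-measurable functions. The separate clause for an infinite integral matters too, since
  \<open>enn2real\<close> would turn it into 0.\<close>

lemma Lp_norm_le_1D:
  assumes "Lp_norm (ennreal p) M f \<le> 1" "0 < p"
  shows "f \<in> borel_measurable M" and "(\<integral>\<^sup>+ x. ennreal (cmod (f x) powr p) \<partial>M) \<le> 1"
proof -
  show "f \<in> borel_measurable M" using assms(1) by (auto simp: Lp_norm_def top_unique split: if_splits)
  with assms have I: "(\<integral>\<^sup>+ x. ennreal (cmod (f x) powr p) \<partial>M) \<noteq> \<infinity>"
      "enn2real (\<integral>\<^sup>+ x. ennreal (cmod (f x) powr p) \<partial>M) powr (1 / p) \<le> 1"
    by (auto simp: Lp_norm_def Let_def ennreal_le_1 top_unique split: if_splits)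
  define J where "J = enn2real (\<integral>\<^sup>+ x. ennreal (cmod (f x) powr p) \<partial>M)"
  have "(J powr (1 / p)) powr p \<le> 1 powr p"
    using I(2) assms(2) unfolding J_def by (intro powr_mono2) auto
  hence "J \<le> 1" using assms(2) by (simp add: powr_powr J_def)
  moreover have "(\<integral>\<^sup>+ x. ennreal (cmod (f x) powr p) \<partial>M) = ennreal J"
    using I(1) by (simp add: J_def less_top)
  ultimately show "(\<integral>\<^sup>+ x. ennreal (cmod (f x) powr p) \<partial>M) \<le> 1" by (simp add: ennreal_le_1)
qed

section \<open>Parametrization of a radial curve by the distance to the origin\<close>

lemma radius_mono:
  assumes "simple_radial_curve \<gamma>" "i \<le> j" "j \<le> pieces \<gamma>"
  shows "radius \<gamma> i \<le> radius \<gamma> j"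
  using assms(2,3)
proof (induction j rule: dec_induct)
  case (step j)
  have "\<forall>n\<in>{1..pieces \<gamma>}. radius \<gamma> (n - 1) < radius \<gamma> n"
    using assms(1) unfolding simple_radial_curve_def by blast
  from bspec[OF this, of "Suc j"] have "radius \<gamma> (Suc j - 1) < radius \<gamma> (Suc j)"
    using step.prems by simp
  thus ?case using step by simp
qed simp

lemma piece_unique:
  assumes "simple_radial_curve \<gamma>"
    and n: "n \<in> {1..pieces \<gamma>}" "radius \<gamma> (n - 1) \<le> ereal s" "ereal s < radius \<gamma> n"
    and k: "k \<in> {1..pieces \<gamma>}" "radius \<gamma> (k - 1) \<le> ereal s" "ereal s < radius \<gamma> k"
  shows "k = n"
proof (rule ccontr)
  assume "k \<noteq> n"
  then consider "k \<le> n - 1" | "n \<le> k - 1" by linarith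
  thus False
  proof cases
    case 1
    have "radius \<gamma> k \<le> radius \<gamma> (n - 1)" using 1 n(1) by (intro radius_mono[OF assms(1)]) auto
    from less_le_trans[OF k(3) this] show False using n(2) by simp
  next
    case 2
    have "radius \<gamma> n \<le> radius \<gamma> (k - 1)" using 2 k(1) by (intro radius_mono[OF assms(1)]) auto
    from less_le_trans[OF n(3) this] show False using k(2) by simp
  qed
qed

lemma polar_angle_eq:
  assumes "simple_radial_curve \<gamma>" "n \<in> {1..pieces \<gamma>}" "radius \<gamma> (n - 1) \<le> ereal s" "ereal s < radius \<gamma> n"
  shows "polar_angle \<gamma> s = angle \<gamma> n"
proof -
  have "(THE k. k \<in> {1..pieces \<gamma>} \<and> radius \<gamma> (k - 1) \<le> ereal s \<and> ereal s < radius \<gamma> k) = n"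
    using assms(2-4) by (intro the_equality piece_unique[OF assms]) simp_all
  thus ?thesis by (simp add: polar_angle_def)
qed

lemma piece_exists:
  assumes "radius \<gamma> 0 \<le> ereal s" "ereal s < radius \<gamma> (pieces \<gamma>)"
  obtains n where "n \<in> {1..pieces \<gamma>}" "radius \<gamma> (n - 1) \<le> ereal s" "ereal s < radius \<gamma> n"
proof
  \<comment> \<open>The first radius above s: minimality is exactly the inequality at the preceding
    index, and n \<noteq> 0 because s is not below the initial radius.\<close>
  define n where "n = (LEAST n. ereal s < radius \<gamma> n)"
  show n: "ereal s < radius \<gamma> n" unfolding n_def using assms(2) by (rule LeastI)
  hence n0: "n \<noteq> 0" using assms(1) by (metis leD)
  show "n \<in> {1..pieces \<gamma>}" using n0 Least_le[of "\<lambda>n. ereal s < radius \<gamma> n", OF assms(2)] by (auto simp: n_def)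
  show "radius \<gamma> (n - 1) \<le> ereal s"
    using not_less_Least[of "n - 1" "\<lambda>n. ereal s < radius \<gamma> n"] n0 by (auto simp: n_def not_less)
qed

text \<open>A Borel parametrization of the whole line that agrees with the polar one on the range
  \<open>D\<close> of the curve, so the image measures coincide. A curve starting at the origin has
  s = 0 in \<open>D\<close>, where the real part is 0; the half-plane condition is therefore
  asserted for s > 0, and the exceptional point is null.\<close>

lemma radial_curve_parametrization:
  assumes \<gamma>: "simple_radial_curve \<gamma>"
  obtains D z where "D \<in> sets borel" "z \<in> borel_measurable borel"
    "\<And>s. s \<in> D \<Longrightarrow> 0 < s \<Longrightarrow> norm (z s) = s \<and> 0 < Re (z s)"
    "AE s in lborel. s \<in> D \<longrightarrow> 0 < s"
    "curve_measure \<gamma> = distr (restrict_space lborel D) borel z"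
proof
  let ?P = "\<lambda>n s. radius \<gamma> (n - 1) \<le> ereal s \<and> ereal s < radius \<gamma> n"
  define D where "D = {s. radius \<gamma> 0 \<le> ereal s \<and> ereal s < radius \<gamma> (pieces \<gamma>)}"
  \<comment> \<open>\<open>polar_angle\<close> is a definite description, from which measurability
    cannot be read off. On \<open>D\<close> exactly one summand is active, and it carries the same
    angle.\<close>
  define \<alpha> where "\<alpha> s = (\<Sum>n\<in>{1..pieces \<gamma>}. if ?P n s then angle \<gamma> n else 0)" for s
  define z where "z s = complex_of_real s * cis (\<alpha> s)" for s
  have "D = {s \<in> space borel. radius \<gamma> 0 \<le> ereal s \<and> ereal s < radius \<gamma> (pieces \<gamma>)}" by (simp add: D_def)
  also have "\<dots> \<in> sets borel" by measurable
  finally show D: "D \<in> sets borel" .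
  have "(\<lambda>s. \<alpha> s) \<in> borel_measurable borel" unfolding \<alpha>_def by measurable
  thus z: "z \<in> borel_measurable borel" unfolding z_def cis_conv_exp by measurable
  have \<alpha>: "\<alpha> s = polar_angle \<gamma> s \<and> \<alpha> s \<in> {- pi / 2 <..< pi / 2}" if "s \<in> D" for s
  proof -
    from that obtain n where n: "n \<in> {1..pieces \<gamma>}" "?P n s" by (auto simp: D_def elim: piece_exists)
    have "?P k s \<longleftrightarrow> k = n" if "k \<in> {1..pieces \<gamma>}" for k
      using piece_unique[OF \<gamma> n(1) _ _ that] n(2) by auto
    hence "\<alpha> s = (\<Sum>k\<in>{1..pieces \<gamma>}. if k = n then angle \<gamma> k else 0)"
      unfolding \<alpha>_def by (intro sum.cong) auto
    also have "\<dots> = angle \<gamma> n" using n(1) by simp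
    finally show ?thesis using polar_angle_eq[OF \<gamma> n(1)] n \<gamma> by (auto simp: simple_radial_curve_def)
  qed
  show "norm (z s) = s \<and> 0 < Re (z s)" if "s \<in> D" "0 < s" for s
    using \<alpha>[OF that(1)] that(2) by (simp add: z_def norm_mult cos_gt_zero_pi)
  have nonneg: "0 \<le> s" if "s \<in> D" for s
  proof -
    have "0 \<le> radius \<gamma> 0" using \<gamma> by (simp add: simple_radial_curve_def)
    also have "\<dots> \<le> ereal s" using that by (simp add: D_def)
    finally show ?thesis by simp
  qed
  show "AE s in lborel. s \<in> D \<longrightarrow> 0 < s"
    using AE_lborel_singleton[of "0 :: real"] by eventually_elim (use nonneg in \<open>auto simp: less_le\<close>)
  show "curve_measure \<gamma> = distr (restrict_space lborel D) borel z"
    unfolding curve_measure_def D_def[symmetric]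
    by (intro distr_cong refl) (simp add: z_def space_restrict_space \<alpha>)
qed

section \<open>The norm bound on a single curve\<close>

lemma norm_laplace_le_1:
  assumes f [measurable]: "f \<in> borel_measurable half_line"
    and f1: "(\<integral>\<^sup>+ t. ennreal (norm (f t)) \<partial>half_line) \<le> 1" and "0 < Re w"
  shows "norm (laplace f w) \<le> 1"
proof -
  have fi: "integrable half_line f"
    using f1 by (intro integrableI_bounded) (auto intro: le_less_trans)
  have "norm (laplace f w) \<le> (\<integral>t. norm (f t) \<partial>half_line)"
    unfolding laplace_def
  proof (rule norm_integral_le)
    fix t assume "t \<in> space half_line"
    hence "0 < t" by (simp add: half_line_def space_restrict_space)
    hence "norm (exp (- (w * complex_of_real t))) \<le> 1" using \<open>0 < Re w\<close> by simp
    from mult_left_mono[OF this, of "norm (f t)"]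
    show "norm (f t * exp (- (w * complex_of_real t))) \<le> norm (f t)" by (simp add: norm_mult)
  qed (use fi in simp)
  also have "ennreal (\<integral>t. norm (f t) \<partial>half_line) = (\<integral>\<^sup>+ t. ennreal (norm (f t)) \<partial>half_line)"
    using fi by (intro nn_integral_eq_integral[symmetric]) auto
  hence "(\<integral>t. norm (f t) \<partial>half_line) \<le> 1" using f1 by (metis ennreal_le_1)
  finally show ?thesis .
qed

text \<open>1 - 1/p is positive, so subtraction in \<open>ennreal\<close> is harmless and
  \<open>p'\<close> is finite. The real exponent p / (p - 1) can then be used in the finite clause
  of \<open>Lp_norm\<close>.\<close>

lemma conjugate_exponent:
  assumes "1 < p" "inverse (ennreal p) + inverse p' = 1"
  shows "p' = ennreal (p / (p - 1))"
proof -
  have ip: "inverse (ennreal p) = ennreal (1 / p)" using assms(1) by (simp add: inverse_ennreal inverse_eq_divide)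
  have "inverse p' = 1 - ennreal (1 / p)"
    using assms(2) unfolding ip by (metis ennreal_add_diff_cancel_left ennreal_neq_top)
  also have "\<dots> = ennreal (1 - 1 / p)" using assms(1) by (subst ennreal_minus[symmetric]) auto
  finally have ip': "inverse p' = ennreal (1 - 1 / p)" .
  have pos: "0 < 1 - 1 / p" using assms(1) by simp
  have "p' \<noteq> top" using ip' pos by auto
  moreover have "p' \<noteq> 0" using ip' by auto
  ultimately obtain r where r: "p' = ennreal r" "0 < r"
    by (metis ennreal_cases ennreal_0 less_eq_real_def)
  hence "ennreal (inverse r) = ennreal (1 - 1 / p)" using ip' by (simp add: inverse_ennreal)
  hence "inverse r = 1 - 1 / p" using pos r(2) by (subst (asm) ennreal_inj) auto
  hence "r = inverse (1 - 1 / p)" by (metis inverse_inverse_eq)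
  also have "\<dots> = p / (p - 1)" using assms(1) by (simp add: field_simps)
  finally show ?thesis using r(1) by simp
qed

text \<open>For p > 1 the arclength integral becomes an integral over the radius, where
  \<open>laplace_Lq_bound\<close> applies; its 1/q-th power is the claim. For p = 1 the norm is an
  essential supremum and is treated separately.\<close>

lemma Lp_norm_laplace_le:
  assumes p: "1 \<le> p" "p \<le> 2" "inverse (ennreal p) + inverse p' = 1"
    and \<gamma>: "simple_radial_curve \<gamma>" and f1: "Lp_norm (ennreal p) half_line f \<le> 1"
  shows "Lp_norm p' (curve_measure \<gamma>) (laplace f) \<le> ennreal ((384 * pi) powr enn2real (inverse p'))"
proof -
  have "0 < p" using p by simp
  note f = Lp_norm_le_1D[OF f1 this]
  note [measurable] = f(1)
  have lm [measurable]: "laplace f \<in> borel_measurable borel" by (rule measurable_laplace[OF f(1)])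
  obtain D z where D: "D \<in> sets borel" and z: "z \<in> borel_measurable borel"
    and zD: "\<And>s. s \<in> D \<Longrightarrow> 0 < s \<Longrightarrow> norm (z s) = s \<and> 0 < Re (z s)"
    and AE0: "AE s in lborel. s \<in> D \<longrightarrow> 0 < s"
    and cm: "curve_measure \<gamma> = distr (restrict_space lborel D) borel z"
    using radial_curve_parametrization[OF \<gamma>] by blast
  note [measurable] = D z
  have zr [measurable]: "z \<in> borel_measurable (restrict_space lborel D)"
    by (rule measurable_restrict_space1) simp
  have lc: "laplace f \<in> borel_measurable (curve_measure \<gamma>)" by (simp add: cm lm)
  show ?thesis
  proof (cases "p = 1")
    case True
    \<comment> \<open>Here p' = \<infinity>, so the exponent on the right is 0 and the claimed bound
      is (384 pi) powr 0 = 1.\<close>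
    have "inverse p' = 0"
      using p(3) True ennreal_add_left_cancel[of 1 "inverse p'" 0] by simp
    hence p': "p' = \<infinity>" by simp
    have "AE w in curve_measure \<gamma>. ennreal (cmod (laplace f w)) \<le> 1"
      unfolding cm
    proof (subst AE_distr_iff)
      show "AE s in restrict_space lborel D. ennreal (cmod (laplace f (z s))) \<le> 1"
      proof (subst AE_restrict_space_iff)
        show "AE s in lborel. s \<in> D \<longrightarrow> ennreal (cmod (laplace f (z s))) \<le> 1"
          using AE0
        proof eventually_elim
          case (elim s)
          thus ?case using norm_laplace_le_1[OF f(1), of "z s"] f(2) zD[of s] True by (auto simp: ennreal_le_1)
        qed
      qed simp
    qed (auto intro!: zr)
    hence "esssup (curve_measure \<gamma>) (\<lambda>w. ennreal (cmod (laplace f w))) \<le> 1"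
      by (rule esssup_I[rotated]) (use lc in simp)
    thus ?thesis using lc by (simp add: Lp_norm_def p')
  next
    case False
    hence p1: "1 < p" using p by simp
    define q where "q = p / (p - 1)"
    have p': "p' = ennreal q" unfolding q_def by (rule conjugate_exponent[OF p1 p(3)])
    have q: "0 < q" "1 / p + 1 / q = 1" using p1 by (auto simp: q_def field_simps)
    define f' where "f' t = indicat_real {0<..} t *\<^sub>R f t" for t
    have f'm [measurable]: "f' \<in> borel_measurable borel"
      using f(1) unfolding half_line_def f'_def by (simp add: borel_measurable_restrict_space_iff)
    have f'1: "(\<integral>\<^sup>+ t. ennreal (norm (f' t) powr p) * indicator {0<..} t \<partial>lborel) \<le> 1"
    proof -
      have "(\<integral>\<^sup>+ t. ennreal (norm (f' t) powr p) * indicator {0<..} t \<partial>lborel) = (\<integral>\<^sup>+ t. ennreal (norm (f t) powr p) \<partial>half_line)"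
        unfolding half_line_nn_integral by (intro nn_integral_cong) (auto simp: f'_def indicator_def)
      thus ?thesis using f(2) by simp
    qed
    have lap: "laplace f w = (\<integral>t. indicat_real {0<..} t *\<^sub>R (exp (- (w * complex_of_real t)) * f' t) \<partial>lborel)" for w
      unfolding laplace_def half_line_set_integral
      by (intro Bochner_Integration.integral_cong) (auto simp: f'_def indicator_def)
    define S where "S = D \<inter> {0<..}"
    have S: "S \<in> sets borel" unfolding S_def by measurable
    have "(\<integral>\<^sup>+ w. ennreal (cmod (laplace f w) powr q) \<partial>curve_measure \<gamma>) =
      (\<integral>\<^sup>+ s. ennreal (cmod (laplace f (z s)) powr q) \<partial>restrict_space lborel D)"
      unfolding cm by (rule nn_integral_distr[OF zr]) measurable
    also have "\<dots> = (\<integral>\<^sup>+ s. ennreal (cmod (laplace f (z s)) powr q) * indicator D s \<partial>lborel)"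
      by (rule nn_integral_restrict_space) simp
    also have "\<dots> = (\<integral>\<^sup>+ s. ennreal (cmod (laplace f (z s)) powr q) * indicator S s \<partial>lborel)"
    proof (rule nn_integral_cong_AE)
      show "AE s in lborel. ennreal (cmod (laplace f (z s)) powr q) * indicator D s = ennreal (cmod (laplace f (z s)) powr q) * indicator S s"
        using AE0 by eventually_elim (auto simp: S_def indicator_def)
    qed
    also have "\<dots> \<le> ennreal (384 * pi)"
      unfolding lap by (rule laplace_Lq_bound[OF f'm z S _ p1 p(2) q(2) f'1]) (use zD in \<open>auto simp: S_def\<close>)
    finally have I: "(\<integral>\<^sup>+ w. ennreal (cmod (laplace f w) powr q) \<partial>curve_measure \<gamma>) \<le> ennreal (384 * pi)" .
    define J where "J = enn2real (\<integral>\<^sup>+ w. ennreal (cmod (laplace f w) powr q) \<partial>curve_measure \<gamma>)"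
    have "J \<le> 384 * pi" unfolding J_def by (rule enn2real_leI[OF _ I]) simp
    hence "J powr (1 / q) \<le> (384 * pi) powr (1 / q)" using q(1) by (intro powr_mono2) (auto simp: J_def)
    moreover have "enn2real (inverse p') = 1 / q"
      using q(1) by (simp add: p' inverse_ennreal inverse_eq_divide)
    moreover have "(\<integral>\<^sup>+ w. ennreal (cmod (laplace f w) powr q) \<partial>curve_measure \<gamma>) \<noteq> \<infinity>"
      using I by (auto simp: top_unique)
    ultimately show ?thesis using lc q(1) by (simp add: Lp_norm_def p' Let_def J_def)
  qed
qed

theorem theorem11:
  fixes \<nu> :: nat and c p :: real and p' :: ennreal
  assumes "1 \<le> \<nu>" and "1 < c"
    and "1 \<le> p" and "p \<le> 2"
    and "inverse (ennreal p) + inverse p' = 1"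
  shows "K11 (ennreal p) p' \<nu> c < \<infinity>
    \<and> K11 (ennreal p) p' \<nu> c
        \<le> ennreal ((18 * 8 * 24 * (ln 2 / ln c + real \<nu> + 2)) powr enn2real (inverse p'))"
proof -
  \<comment> \<open>Since ln 2 / ln c \<ge> 0 and \<nu> \<ge> 1, the base on the right is at least
    18 * 8 * 24 * 3 = 10368, while 384 pi < 1536. Powers with the nonnegative exponent 1/p' keep the
    order.\<close>
  have "0 \<le> ln 2 / ln c" using assms(2) by simp
  moreover have "1 \<le> real \<nu>" using assms(1) by simp
  ultimately have "3 \<le> ln 2 / ln c + real \<nu> + 2" by simp
  hence "18 * 8 * 24 * 3 \<le> 18 * 8 * 24 * (ln 2 / ln c + real \<nu> + 2)" by (rule mult_left_mono) simp
  moreover have "384 * pi \<le> 18 * 8 * 24 * 3" using pi_less_4 by simp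
  ultimately have "384 * pi \<le> 18 * 8 * 24 * (ln 2 / ln c + real \<nu> + 2)" by (rule order_trans[rotated])
  hence const: "(384 * pi) powr enn2real (inverse p') \<le> (18 * 8 * 24 * (ln 2 / ln c + real \<nu> + 2)) powr enn2real (inverse p')"
    by (intro powr_mono2) auto
  have "K11 (ennreal p) p' \<nu> c \<le> ennreal ((384 * pi) powr enn2real (inverse p'))"
    unfolding K11_def Lp_operator_norm_def
    using assms(3-5) by (intro SUP_least Lp_norm_laplace_le) (auto simp: radial_class_def)
  also have "\<dots> \<le> ennreal ((18 * 8 * 24 * (ln 2 / ln c + real \<nu> + 2)) powr enn2real (inverse p'))"
    using const by (rule ennreal_leI)
  finally show ?thesis by (auto intro: le_less_trans)
qed

end
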